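(* Let $B$ be a non-empty bouquet (one having at least one edge). Then ${}^{\partial}\varepsilon_{B}(z)=2^{e(B)}z^{b}$ for some integer $b\ge 0$ if and only if $B=B_{t_1}\vee\cdots\vee B_{t_k}$ (some ribbon-join) for some $k\ge 1$ and some $B_{t_i}\in\mathcal{B}$, $1\le i\le k$, where $\mathcal{B}=\{B_{\overline{1}},B_1,B_3,B_5,\ldots\}$. Furthermore, in this case, if the number of the factors $B_{t_i}$ equal to $B_{\overline{1}}$ is $k_2$, then $b=e(B)-k+k_2$.
   Context: Ribbon graphs are finite, possibly non-orientable, considered up to equivalence. For a ribbon graph $G$, let $v(G),e(G),f(G)$ be its numbers of vertices, edges and boundary components. For connected $G$ the Euler genus $\varepsilon(G)$ is defined by $2-\varepsilon(G)=v(G)-e(G)+f(G)$. For $A\subseteq E(G)$ the partial dual $G^{A}$ is obtained as follows: take the spanning ribbon subgraph $(V(G),A)$, glue a disc to $G$ along each boundary component of this subgraph (these discs are the vertex-discs of $G^A$), and remove the interiors of all vertex-discs of $G$; the edge-ribbons are kept as the edges of $G^A$. The partial-dual Euler genus polynomial of $G$ is ${}^{\partial}\varepsilon_{G}(z)=\sum_{A\subseteq E(G)}z^{\varepsilon(G^{A})}$. A bouquet is a ribbon graph with exactly one vertex. A loop $e$ at the vertex-disc $v$ is twisted if $e\cup v$ is homeomorphic to a Möbius band, and untwisted otherwise. A bouquet is represented by a signed rotation: the cyclic ordering of its half-edges around the vertex, where the two half-edges of an untwisted loop get the same sign $+$ and the two half-edges of a twisted loop get different signs (one $+$, one $-$);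 the sign $+$ is omitted. $B_{\overline{1}}$ is the bouquet with signed rotation $(1,-1)$ (one twisted loop). For $t\geq 1$, $B_t$ is the bouquet with signed rotation $(1,2,\ldots,t,1,2,\ldots,t)$. A ribbon-join $P\vee Q$ of two disjoint ribbon graphs $P,Q$ is obtained by choosing an arc on the boundary of a vertex-disc of $P$ lying between two consecutive ribbon ends, choosing likewise an arc on the boundary of a vertex-disc of $Q$, and pasting the two vertex-discs together along these arcs into one vertex-disc. For bouquets this means cutting the two cyclic signed rotations open into words and concatenating the words into one cyclic word. The ribbon-join is in general not unique; $B=B_{t_1}\vee\cdots\vee B_{t_k}$ means that $B$ can be obtained by some iterated ribbon-join of these bouquets. *)

theory Defs
  imports "HOL-Computational_Algebra.Polynomial"
begin

text \<open>
  A ribbon graph is encoded by the corners (flags) of its edge-ribbons. Every edge-ribbon is a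
  rectangle with four corners. Two opposite edges of the rectangle are the ribbon ends, glued
  to the boundaries of vertex-discs; the other two are its sides, which lie on the boundary of
  the surface. What is left of the boundaries of the vertex-discs is a set of arcs, each running
  from a corner of one ribbon end to a corner of the next. Each of the three functions maps a
  corner to the other endpoint of the segment of the respective kind.

  Isolated vertices carry no flags and are not represented. A bouquet with at least one edge
  has none, and neither do its partial duals.
\<close>

record 'a ribbon_graph =
  flags :: "'a set"
  ribbon_end :: "'a \<Rightarrow> 'a"
  ribbon_side :: "'a \<Rightarrow> 'a"
  vertex_arc :: "'a \<Rightarrow> 'a"

definition fixpoint_free_involution_on :: "'a set \<Rightarrow> ('a \<Rightarrow> 'a) \<Rightarrow> bool" where
  "fixpoint_free_involution_on X f \<longleftrightarrow> (\<forall>x\<in>X. f x \<in> X \<and> f x \<noteq> x \<and> f (f x) = x)"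

definition is_ribbon_graph :: "'a ribbon_graph \<Rightarrow> bool" where
  "is_ribbon_graph G \<longleftrightarrow>
     finite (flags G) \<and>
     fixpoint_free_involution_on (flags G) (ribbon_end G) \<and>
     fixpoint_free_involution_on (flags G) (ribbon_side G) \<and>
     fixpoint_free_involution_on (flags G) (vertex_arc G) \<and>
     (\<forall>x\<in>flags G. ribbon_end G (ribbon_side G x) = ribbon_side G (ribbon_end G x) \<and>
                  ribbon_end G (ribbon_side G x) \<noteq> x)"

text \<open>
  Equivalence of ribbon graphs. Orientations of vertex-discs are not part of the data, so
  homeomorphisms that reverse some or all of them are included.
\<close>

definition ribbon_equiv :: "'a ribbon_graph \<Rightarrow> 'b ribbon_graph \<Rightarrow> bool" where
  "ribbon_equiv G H \<longleftrightarrow> (\<exists>\<phi>. bij_betw \<phi> (flags G) (flags H) \<and>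
     (\<forall>x\<in>flags G. \<phi> (ribbon_end G x) = ribbon_end H (\<phi> x) \<and>
                  \<phi> (ribbon_side G x) = ribbon_side H (\<phi> x) \<and>
                  \<phi> (vertex_arc G x) = vertex_arc H (\<phi> x)))"

text \<open>
  The orbits of two involutions; each is the set of corners met by a closed curve that
  alternates between segments of the two kinds.
\<close>

definition orbits :: "'a set \<Rightarrow> ('a \<Rightarrow> 'a) \<Rightarrow> ('a \<Rightarrow> 'a) \<Rightarrow> 'a set set" where
  "orbits X f g = X // {(x, y). x \<in> X \<and> (y = f x \<or> y = g x)}\<^sup>*"

definition vertices :: "'a ribbon_graph \<Rightarrow> 'a set set" where
  "vertices G = orbits (flags G) (ribbon_end G) (vertex_arc G)"

definition edges :: "'a ribbon_graph \<Rightarrow> 'a set set" where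
  "edges G = orbits (flags G) (ribbon_end G) (ribbon_side G)"

definition boundary_components :: "'a ribbon_graph \<Rightarrow> 'a set set" where
  "boundary_components G = orbits (flags G) (ribbon_side G) (vertex_arc G)"

text \<open>Meaningful for connected ribbon graphs only; bouquets and their partial duals are connected.\<close>

definition euler_genus :: "'a ribbon_graph \<Rightarrow> int" where
  "euler_genus G =
     2 - (int (card (vertices G)) - int (card (edges G)) + int (card (boundary_components G)))"

text \<open>
  Besides the vertex arcs, the boundary of the spanning ribbon subgraph with edge set \<open>A\<close>
  consists of the sides of the ribbons in \<open>A\<close> and of the segments along which the ends
  of the deleted ribbons were attached. The vertex-discs of the partial dual are glued along these
  boundary curves, so these segments become the ribbon ends. The segments of the ribbons that
  do not lie on these curves become the ribbon sides.
\<close>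

definition partial_dual :: "'a ribbon_graph \<Rightarrow> 'a set set \<Rightarrow> 'a ribbon_graph" where
  "partial_dual G A = \<lparr>
     flags = flags G,
     ribbon_end = (\<lambda>x. if x \<in> \<Union>A then ribbon_side G x else ribbon_end G x),
     ribbon_side = (\<lambda>x. if x \<in> \<Union>A then ribbon_end G x else ribbon_side G x),
     vertex_arc = vertex_arc G\<rparr>"

text \<open>The Euler genus of a connected ribbon graph is nonnegative, so \<^const>\<open>nat\<close> does not truncate.\<close>

definition partial_dual_genus_poly :: "'a ribbon_graph \<Rightarrow> int poly" where
  "partial_dual_genus_poly G =
     (\<Sum>A\<in>Pow (edges G). monom 1 (nat (euler_genus (partial_dual G A))))"

definition is_bouquet :: "'a ribbon_graph \<Rightarrow> bool" where
  "is_bouquet G \<longleftrightarrow> is_ribbon_graph G \<and> card (vertices G) = 1"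


datatype sign = Plus | Minus

type_synonym signed_rotation = "(nat \<times> sign) list"

text \<open>Intended for words in which every label occurs exactly twice.\<close>

definition partner :: "signed_rotation \<Rightarrow> nat \<Rightarrow> nat" where
  "partner w i = (THE j. j < length w \<and> j \<noteq> i \<and> fst (w ! j) = fst (w ! i))"

text \<open>
  The half-edge at position \<open>i\<close> of the word has the corners \<open>(i, False)\<close> and
  \<open>(i, True)\<close>, in this order along the boundary of the vertex-disc. The ribbon of an
  untwisted loop joins the first corner of one half-edge to the second corner of the other;
  for a twisted loop, first corners are joined to first corners.
\<close>

definition bouquet_of :: "signed_rotation \<Rightarrow> (nat \<times> bool) ribbon_graph" where
  "bouquet_of w = (let n = length w in \<lparr>
     flags = {..<n} \<times> UNIV,
     ribbon_end = (\<lambda>(i, s). (i, \<not> s)),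
     ribbon_side = (\<lambda>(i, s). (partner w i,
        if snd (w ! partner w i) = snd (w ! i) then \<not> s else s)),
     vertex_arc = (\<lambda>(i, s). if s then ((i + 1) mod n, False) else ((i + n - 1) mod n, True))\<rparr>)"

definition B_twisted :: "(nat \<times> bool) ribbon_graph" where
  "B_twisted = bouquet_of [(1, Plus), (1, Minus)]"

definition B_untwisted :: "nat \<Rightarrow> (nat \<times> bool) ribbon_graph" where
  "B_untwisted t = bouquet_of (map (\<lambda>i. (i, Plus)) ([1..<t + 1] @ [1..<t + 1]))"

definition B_family :: "(nat \<times> bool) ribbon_graph set" where
  "B_family = {B_twisted} \<union> {B_untwisted t | t. odd t}"


text \<open>
  Pasting a piece of the arc at the corner \<open>x\<close> to a piece of the arc at \<open>y\<close> leaves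
  two arcs: one from \<open>x\<close> to \<open>y\<close>, and one joining the other two endpoints. The
  opposite way of pasting the same two arcs is obtained by taking the other endpoint for \<open>y\<close>.
\<close>

definition ribbon_join :: "'a ribbon_graph \<Rightarrow> 'a \<Rightarrow> 'a ribbon_graph \<Rightarrow> 'a \<Rightarrow> 'a ribbon_graph" where
  "ribbon_join P x Q y = \<lparr>
     flags = flags P \<union> flags Q,
     ribbon_end = (\<lambda>z. if z \<in> flags P then ribbon_end P z else ribbon_end Q z),
     ribbon_side = (\<lambda>z. if z \<in> flags P then ribbon_side P z else ribbon_side Q z),
     vertex_arc = (\<lambda>z. if z \<in> flags P then vertex_arc P z else vertex_arc Q z)
       (x := y, y := x, vertex_arc P x := vertex_arc Q y, vertex_arc Q y := vertex_arc P x)\<rparr>"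

inductive iterated_ribbon_join :: "'a ribbon_graph list \<Rightarrow> 'a ribbon_graph \<Rightarrow> bool" where
  single: "is_ribbon_graph P \<Longrightarrow> iterated_ribbon_join [P] P"
| join: "\<lbrakk>iterated_ribbon_join Ps P; iterated_ribbon_join Qs Q; flags P \<inter> flags Q = {};
          x \<in> flags P; y \<in> flags Q\<rbrakk>
         \<Longrightarrow> iterated_ribbon_join (Ps @ Qs) (ribbon_join P x Q y)"

text \<open>
  Factors and join are taken over the flag type of \<open>B\<close>. This is no restriction: a join
  equivalent to \<open>B\<close> has as many flags as \<open>B\<close>, so it can be transported, together
  with its factors, to the flags of \<open>B\<close>.
\<close>

definition is_B_family_join :: "'a ribbon_graph \<Rightarrow> 'a ribbon_graph list \<Rightarrow> bool" where
  "is_B_family_join B Ps \<longleftrightarrow>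
     (\<forall>P\<in>set Ps. \<exists>C\<in>B_family. ribbon_equiv P C) \<and> (\<exists>R. iterated_ribbon_join Ps R \<and> ribbon_equiv B R)"

end

theory Submission
  imports Defs
begin

text \<open>
  Let \<open>nb A\<close> be the number of boundary components of the spanning ribbon subgraph with edge set
  \<open>A\<close>. The Euler genus of the partial dual is \<open>2 + e(B) - nb A - nb (E - A)\<close>, so the polynomial is a
  monomial iff \<open>nb A + nb (E - A)\<close> does not depend on \<open>A\<close>. A ribbon-join adds the values of \<open>nb\<close> and
  subtracts one; the sum is 2 for the twisted loop and 3 for \<open>B\<^sub>t\<close> with \<open>t\<close> odd, since there \<open>nb A\<close>
  is 1 or 2 according to the parity of the size of \<open>A\<close>. This gives one direction and the exponent.

  Conversely, assume that the sum is constant. Comparing \<open>A = {}\<close> with sets \<open>A\<close> of one or two loops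
  determines how \<open>nb\<close> changes when these loops are removed from \<open>B\<close>. It follows that a twisted loop
  crosses no other loop, and that two untwisted loops cross iff their ribbon sides lie on the same two
  boundary components of \<open>B\<close>. Hence crossing is transitive. If all loops cross each other, the
  bouquet is the twisted loop or \<open>B\<^sub>t\<close>, and \<open>t\<close> is odd because the sides of an untwisted loop lie on
  different boundary components. Otherwise, a gap of one crossing class in the cyclic rotation is closed
  under taking the other end of a loop, and cutting it off presents \<open>B\<close> as a ribbon-join.
\<close>

subsection \<open>Rewiring one of two involutions\<close>

text \<open>Boundary curves are orbits of two involutions; they carry no cyclic order or
  orientation. Adding a ribbon, deleting one and ribbon-joining are the same operation: two segments
  of one involution are exchanged for two others with the same four endpoints. An exchange merges
  two curves, splits one, or leaves all sets of corners as they are, so it changes the count by at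
  most one.

  Constancy works as a dictionary between small subgraphs and deletions from \<open>B\<close>. Since
  \<open>nb {} = 1\<close>, deleting the loops in \<open>A\<close> lowers the count by
  \<open>nb A - 1\<close>: by nothing for a twisted loop or for two crossing loops of which at least
  one is untwisted, by one for an untwisted loop, by two for two untwisted loops that do not cross.
  Whether a deletion lowers the count can be read off from the components through the two corners of
  a ribbon end. This turns interlacement, which is not transitive in general, into an equality of
  sets, which is. The cutting step rests on that transitivity: a loop leaving the gap would separate
  two loops of one class that must cross.\<close>

abbreviation ffi :: "'a set \<Rightarrow> ('a \<Rightarrow> 'a) \<Rightarrow> bool" where
  "ffi \<equiv> fixpoint_free_involution_on"

lemma ffiD:
  assumes "ffi X f" "x \<in> X"
  shows "f x \<in> X" "f x \<noteq> x" "f (f x) = x"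
  using assms by (auto simp: fixpoint_free_involution_on_def)

lemma even_card_ffi:
  assumes "finite X" "ffi X f"
  shows "even (card X)"
  using assms
proof (induction X rule: finite_psubset_induct)
  case (psubset X)
  show ?case
  proof (cases "X = {}")
    case False
    then obtain x where x: "x \<in> X" by blast
    note fx = ffiD[OF psubset.prems x]
    have "ffi (X - {x, f x}) f"
      unfolding fixpoint_free_involution_on_def
    proof
      fix u assume u: "u \<in> X - {x, f x}"
      then have "u \<in> X" by blast
      note fu = ffiD[OF psubset.prems this]
      have "f u \<noteq> x" "f u \<noteq> f x" using u fu fx by auto
      then show "f u \<in> X - {x, f x} \<and> f u \<noteq> u \<and> f (f u) = u" using fu by blast
    qed
    then have "even (card (X - {x, f x}))"
      using x by (intro psubset.IH) auto
    moreover have "card (X - {x, f x}) = card X - 2"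
      using psubset.hyps fx x by (subst card_Diff_subset) auto
    moreover have "card X \<ge> card {x, f x}"
      using fx x psubset.hyps by (intro card_mono) auto
    ultimately show ?thesis using fx by simp
  qed simp
qed

text \<open>The intersection with \<open>X \<times> X\<close> drops the diagonal pairs outside
  \<open>X\<close> that the reflexive closure contains; only then is this an equivalence on
  \<open>X\<close>, as facts about quotients require.\<close>

definition orel :: "'a set \<Rightarrow> ('a \<Rightarrow> 'a) \<Rightarrow> ('a \<Rightarrow> 'a) \<Rightarrow> ('a \<times> 'a) set" where
  "orel X f g = {(x, y). x \<in> X \<and> (y = f x \<or> y = g x)}\<^sup>* \<inter> X \<times> X"

lemma orel_refl: "x \<in> X \<Longrightarrow> (x, x) \<in> orel X f g"
  by (simp add: orel_def)

lemma orel_trans: "(x, y) \<in> orel X f g \<Longrightarrow> (y, z) \<in> orel X f g \<Longrightarrow> (x, z) \<in> orel X f g"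
  by (auto simp: orel_def)

lemma orel_dom: "(x, y) \<in> orel X f g \<Longrightarrow> x \<in> X \<and> y \<in> X"
  by (auto simp: orel_def)

lemma orel_step:
  assumes "ffi X f" "ffi X g" "x \<in> X"
  shows "(x, f x) \<in> orel X f g" "(x, g x) \<in> orel X f g"
  using assms by (auto simp: orel_def fixpoint_free_involution_on_def intro!: r_into_rtrancl)

lemma orel_closed:
  assumes "(x, y) \<in> orel X f g" "x \<in> Z" "\<And>z. z \<in> Z \<Longrightarrow> f z \<in> Z" "\<And>z. z \<in> Z \<Longrightarrow> g z \<in> Z"
  shows "y \<in> Z"
proof -
  have "(x, y) \<in> {(x, y). x \<in> X \<and> (y = f x \<or> y = g x)}\<^sup>*"
    using assms(1) by (simp add: orel_def)
  then show ?thesis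
    by (induction rule: rtrancl_induct) (use assms in auto)
qed

lemma equiv_orel:
  assumes "ffi X f" "ffi X g"
  shows "equiv X (orel X f g)"
proof (rule equivI)
  show "orel X f g \<subseteq> X \<times> X" by (auto simp: orel_def)
  show "refl_on X (orel X f g)" by (auto simp: orel_def refl_on_def)
  show "trans (orel X f g)" by (meson orel_trans transI)
  show "sym (orel X f g)"
  proof (rule symI)
    fix x y assume xy: "(x, y) \<in> orel X f g"
    have "y \<in> {y \<in> X. (y, x) \<in> orel X f g}"
    proof (rule orel_closed[OF xy])
      show "x \<in> {y \<in> X. (y, x) \<in> orel X f g}" using orel_dom[OF xy] by (simp add: orel_refl)
    next
      fix z assume z: "z \<in> {y \<in> X. (y, x) \<in> orel X f g}"
      have "(f z, f (f z)) \<in> orel X f g"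
        using z ffiD[OF assms(1)] orel_step[OF assms, of "f z"] by auto
      then show "f z \<in> {y \<in> X. (y, x) \<in> orel X f g}"
        using z ffiD[OF assms(1)] orel_trans by fastforce
    next
      fix z assume z: "z \<in> {y \<in> X. (y, x) \<in> orel X f g}"
      have "(g z, g (g z)) \<in> orel X f g"
        using z ffiD[OF assms(2)] orel_step[OF assms, of "g z"] by auto
      then show "g z \<in> {y \<in> X. (y, x) \<in> orel X f g}"
        using z ffiD[OF assms(2)] orel_trans by fastforce
    qed
    then show "(y, x) \<in> orel X f g" by simp
  qed
qed

lemma orel_sym:
  assumes "ffi X f" "ffi X g" "(x, y) \<in> orel X f g"
  shows "(y, x) \<in> orel X f g"
  using equiv_orel[OF assms(1,2)] assms(3) by (meson equivE symD)

lemma orel_least: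
  assumes "equiv X T" "\<And>x. x \<in> X \<Longrightarrow> (x, f x) \<in> T" "\<And>x. x \<in> X \<Longrightarrow> (x, g x) \<in> T"
  shows "orel X f g \<subseteq> T"
proof (rule subrelI)
  fix x y assume xy: "(x, y) \<in> orel X f g"
  have T: "trans T" "T \<subseteq> X \<times> X" "refl_on X T" using assms(1) by (auto simp: equiv_def)
  have "y \<in> {y. (x, y) \<in> T}"
  proof (rule orel_closed[OF xy])
    show "x \<in> {y. (x, y) \<in> T}" using T orel_dom[OF xy] by (auto simp: refl_on_def)
  next
    fix z assume "z \<in> {y. (x, y) \<in> T}"
    then show "f z \<in> {y. (x, y) \<in> T}" "g z \<in> {y. (x, y) \<in> T}"
      using T assms(2,3)[of z] by (auto dest: transD)
  qed
  then show "(x, y) \<in> T" by simp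
qed

lemma orel_cong:
  assumes "\<And>x. x \<in> X \<Longrightarrow> f x = f' x" "\<And>x. x \<in> X \<Longrightarrow> g x = g' x"
  shows "orel X f g = orel X f' g'"
proof -
  have "{(x, y). x \<in> X \<and> (y = f x \<or> y = g x)} = {(x, y). x \<in> X \<and> (y = f' x \<or> y = g' x)}"
    using assms by auto
  then show ?thesis by (simp add: orel_def)
qed

lemma orbits_eq_quotient:
  assumes "ffi X f" "ffi X g"
  shows "orbits X f g = X // orel X f g"
proof -
  let ?r = "{(x, y). x \<in> X \<and> (y = f x \<or> y = g x)}"
  have "y \<in> X" if "(x, y) \<in> ?r\<^sup>*" "x \<in> X" for x y
    using that by (induction rule: rtrancl_induct) (use assms ffiD in auto)
  then have "?r\<^sup>* `` {x} = orel X f g `` {x}" if "x \<in> X" for x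
    using that by (auto simp: orel_def)
  then show ?thesis by (auto simp: orbits_def quotient_def)
qed

lemma finite_quotient_card_ge:
  assumes "equiv X R" "finite X" "S \<subseteq> X" "\<And>x y. x \<in> S \<Longrightarrow> y \<in> S \<Longrightarrow> (x, y) \<in> R \<Longrightarrow> x = y"
  shows "card S \<le> card (X // R)"
proof (rule card_inj_on_le)
  show "inj_on (\<lambda>x. R `` {x}) S"
    using assms by (intro inj_onI) (metis eq_equiv_class subsetD)
  show "(\<lambda>x. R `` {x}) ` S \<subseteq> X // R" using assms(3) by (auto simp: quotient_def)
  show "finite (X // R)" using assms by (meson equiv_type finite_quotient)
qed

lemma card_quotient_merge:
  assumes R: "equiv X R" and fin: "finite X" and xy: "x \<in> X" "y \<in> X" "(x, y) \<notin> R"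
    and M: "M = R \<union> (R `` {x, y}) \<times> (R `` {x, y})"
  shows "card (X // R) = card (X // M) + 1" "equiv X M"
proof -
  let ?C = "R `` {x, y}"
  have sym: "sym R" and tr: "trans R" and rf: "refl_on X R" and sub: "R \<subseteq> X \<times> X"
    using R by (auto simp: equiv_def)
  have cl: "b \<in> ?C" if "a \<in> ?C" "(a, b) \<in> R" for a b
    using that tr by (auto dest: transD)
  show "equiv X M"
  proof (rule equivI)
    show "M \<subseteq> X \<times> X" using sub M by auto
    show "refl_on X M" using rf M by (auto simp: refl_on_def)
    show "sym M" using sym M by (auto simp: sym_def)
    show "trans M"
      using cl tr symD[OF sym] unfolding M trans_def by blast
  qed
  have clC: "M `` {z} = ?C" if "z \<in> ?C" for z
    using that cl unfolding M by blast
  have clN: "M `` {z} = R `` {z}" if "z \<notin> ?C" for z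
    using that unfolding M by blast
  have inC: "z \<in> ?C \<longleftrightarrow> R `` {z} = R `` {x} \<or> R `` {z} = R `` {y}" if "z \<in> X" for z
    using that xy equiv_class_eq_iff[OF R] by auto
  have eq: "X // M = insert ?C (X // R - {R `` {x}, R `` {y}})"
  proof (intro equalityI subsetI)
    fix K assume "K \<in> X // M"
    then obtain z where "z \<in> X" "K = M `` {z}" by (auto elim: quotientE)
    then show "K \<in> insert ?C (X // R - {R `` {x}, R `` {y}})"
      using clC clN inC by (cases "z \<in> ?C") (auto simp: quotientI)
  next
    fix K assume "K \<in> insert ?C (X // R - {R `` {x}, R `` {y}})"
    then consider "K = ?C" | "K \<in> X // R" "K \<noteq> R `` {x}" "K \<noteq> R `` {y}" by blast
    then show "K \<in> X // M"
    proof cases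
      case 1
      have "x \<in> ?C" using xy rf by (auto simp: refl_on_def)
      then show ?thesis using 1 clC xy by (metis quotientI)
    next
      case 2
      then obtain z where z: "z \<in> X" "K = R `` {z}" by (auto elim: quotientE)
      then have "z \<notin> ?C" using 2 inC by blast
      then show ?thesis using z clN by (metis quotientI)
    qed
  qed
  have fq: "finite (X // R)" using R fin by (meson equiv_type finite_quotient)
  have xr: "R `` {x} \<in> X // R" "R `` {y} \<in> X // R" using xy by (auto intro: quotientI)
  have ne: "R `` {x} \<noteq> R `` {y}" using xy R by (metis eq_equiv_class)
  have notin: "?C \<notin> X // R - {R `` {x}, R `` {y}}"
  proof
    assume "?C \<in> X // R - {R `` {x}, R `` {y}}"
    then have "?C \<in> X // R" by blast
    then obtain z where z: "z \<in> X" "?C = R `` {z}" by (rule quotientE)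
    then have "z \<in> ?C" using rf by (auto simp: refl_on_def)
    then have "?C = R `` {x} \<or> ?C = R `` {y}" using inC z by simp
    moreover have "x \<in> ?C" "y \<in> ?C" using rf xy by (auto simp: refl_on_def)
    ultimately have "(x, y) \<in> R \<or> (y, x) \<in> R" by blast
    then show False using xy sym by (auto dest: symD)
  qed
  have "card (X // R) \<ge> 2"
    using card_mono[OF fq, of "{R `` {x}, R `` {y}}"] xr ne by simp
  moreover have "card (X // R - {R `` {x}, R `` {y}}) = card (X // R) - 2"
    using xr ne fq by (subst card_Diff_subset) auto
  ultimately show "card (X // R) = card (X // M) + 1"
    using eq notin fq by simp
qed

text \<open>
  A parity count replaces the cyclic structure of an orbit: if \<open>x\<close> could not reach
  \<open>f x\<close> without using the \<open>f\<close>-segment between them, then both the set \<open>D\<close> reachable in this way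
  and \<open>D - {x}\<close> would carry fixpoint-free involutions.
\<close>

lemma orel_detour:
  assumes f: "ffi X f" and g: "ffi X g" and f': "ffi X f'" and fin: "finite X" and x: "x \<in> X"
    and agree: "\<And>u. (x, u) \<in> orel X f g \<Longrightarrow> u \<noteq> x \<Longrightarrow> u \<noteq> f x \<Longrightarrow> f' u = f u"
  shows "(x, f x) \<in> orel X f' g"
proof (rule ccontr)
  assume neg: "(x, f x) \<notin> orel X f' g"
  let ?D = "{u. (x, u) \<in> orel X f g \<and> (x, u) \<in> orel X f' g}"
  have sub: "?D \<subseteq> X" using orel_dom by fast
  have xD: "x \<in> ?D" using x by (simp add: orel_refl)
  have "ffi ?D g"
    unfolding fixpoint_free_involution_on_def
  proof
    fix u assume u: "u \<in> ?D"
    then have uX: "u \<in> X" using sub by blast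
    show "g u \<in> ?D \<and> g u \<noteq> u \<and> g (g u) = u"
      using u ffiD[OF g uX] orel_trans[OF _ orel_step(2)[OF f g uX]]
        orel_trans[OF _ orel_step(2)[OF f' g uX]] by auto
  qed
  then have "even (card ?D)" by (rule even_card_ffi[OF finite_subset[OF sub fin]])
  moreover have "ffi (?D - {x}) f"
    unfolding fixpoint_free_involution_on_def
  proof (intro ballI)
    fix u assume u: "u \<in> ?D - {x}"
    then have uX: "u \<in> X" and ux: "u \<noteq> f x" using sub neg by auto
    then have "f' u = f u" using u agree by auto
    then have "(x, f u) \<in> orel X f' g" "(x, f u) \<in> orel X f g"
      using u orel_step(1)[OF f' g uX] orel_step(1)[OF f g uX] orel_trans by fastforce+
    moreover have "f u \<noteq> x" using ux ffiD[OF f uX] by auto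
    ultimately show "f u \<in> ?D - {x} \<and> f u \<noteq> u \<and> f (f u) = u" using ffiD[OF f uX] by auto
  qed
  then have "even (card (?D - {x}))"
    by (rule even_card_ffi[OF finite_Diff[OF finite_subset[OF sub fin]]])
  moreover have "card ?D = Suc (card (?D - {x}))"
    using card_Suc_Diff1[OF finite_subset[OF sub fin] xD] by (rule sym)
  ultimately show False by simp
qed

text \<open>The elementary surgery: the segments at \<open>x\<close> and at \<open>y\<close> are
  replaced by one from \<open>x\<close> to \<open>y\<close> and one between their other endpoints.
  Toggling a ribbon is the instance with \<open>sub_edge\<close>, the ribbon-join the instance with
  vertex arcs.\<close>

definition rewires :: "'a set \<Rightarrow> ('a \<Rightarrow> 'a) \<Rightarrow> ('a \<Rightarrow> 'a) \<Rightarrow> 'a \<Rightarrow> 'a \<Rightarrow> bool" where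
  "rewires X f f' x y \<longleftrightarrow> x \<in> X \<and> y \<in> X \<and> y \<noteq> x \<and> y \<noteq> f x \<and>
     f' x = y \<and> f' y = x \<and> f' (f x) = f y \<and> f' (f y) = f x \<and>
     (\<forall>u\<in>X. u \<noteq> x \<longrightarrow> u \<noteq> y \<longrightarrow> u \<noteq> f x \<longrightarrow> u \<noteq> f y \<longrightarrow> f' u = f u)"

lemma rewires_ffi:
  assumes "ffi X f" "rewires X f f' x y"
  shows "ffi X f'"
  unfolding fixpoint_free_involution_on_def
proof (intro ballI)
  fix u assume u: "u \<in> X"
  have x: "x \<in> X" and y: "y \<in> X" and r: "y \<noteq> x" "y \<noteq> f x"
     "f' x = y" "f' y = x" "f' (f x) = f y" "f' (f y) = f x"
    using assms(2) by (auto simp: rewires_def)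
  note X = ffiD[OF assms(1) x] and Y = ffiD[OF assms(1) y] and U = ffiD[OF assms(1) u]
  have "f x \<noteq> f y" using X Y r by metis
  show "f' u \<in> X \<and> f' u \<noteq> u \<and> f' (f' u) = u"
  proof (cases "u \<in> {x, y, f x, f y}")
    case True
    then show ?thesis using X Y r x y \<open>f x \<noteq> f y\<close> by (elim insertE emptyE) simp_all
  next
    case False
    then have "f' u = f u" using assms(2) u by (simp add: rewires_def)
    moreover have "f u \<notin> {x, y, f x, f y}" using False U X Y by auto
    then have "f' (f u) = f (f u)" using assms(2) U by (simp add: rewires_def)
    ultimately show ?thesis using U by simp
  qed
qed

text \<open>Undoing a surgery is again a surgery, so deletion is covered by the analysis of
  addition, and a split is a merge read backwards.\<close>

lemma rewires_back:
  assumes "ffi X f" "rewires X f f' x y"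
  shows "rewires X f' f x (f x)"
  using assms ffiD[OF assms(1)] unfolding rewires_def by metis

text \<open>A closed curve with one segment removed is still a path between the endpoints of that
  segment. The new segments connect the two paths to a single curve, and nothing else
  changes.\<close>

lemma orel_rewire_apart:
  assumes f: "ffi X f" and g: "ffi X g" and fin: "finite X" and rw: "rewires X f f' x y"
    and ap: "(x, y) \<notin> orel X f g"
  defines "C \<equiv> orel X f g `` {x, y}"
  shows "orel X f' g = orel X f g \<union> C \<times> C"
    and "card (X // orel X f g) = card (X // orel X f' g) + 1"
proof -
  have f': "ffi X f'" using rewires_ffi[OF f rw] .
  have x: "x \<in> X" and y: "y \<in> X" and r:
     "f' x = y" "f' y = x" "f' (f x) = f y" "f' (f y) = f x"
     and off: "\<And>u. u \<in> X \<Longrightarrow> u \<noteq> x \<Longrightarrow> u \<noteq> y \<Longrightarrow> u \<noteq> f x \<Longrightarrow> u \<noteq> f y \<Longrightarrow> f' u = f u"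
    using rw by (auto simp: rewires_def)
  note sym = orel_sym[OF f g] and sym' = orel_sym[OF f' g]
  note st = orel_step[OF f g] and st' = orel_step[OF f' g]
  have nfy: "(x, f y) \<notin> orel X f g" "(y, f x) \<notin> orel X f g" "(y, x) \<notin> orel X f g"
    using ap st x y sym orel_trans by metis+
  \<comment> \<open>On the curve through \<open>x\<close> the two matchings differ only at
    \<open>x\<close> and \<open>f x\<close>, because \<open>y\<close> and \<open>f y\<close> lie on
    another curve.\<close>
  have dx: "(x, f x) \<in> orel X f' g"
    by (rule orel_detour[OF f g f' fin x]) (use off ap nfy orel_dom in metis)
  have dy: "(y, f y) \<in> orel X f' g"
    by (rule orel_detour[OF f g f' fin y]) (use off ap nfy orel_dom in metis)
  have 1: "orel X f g \<subseteq> orel X f' g"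
  proof (rule orel_least[OF equiv_orel[OF f' g]])
    fix u assume u: "u \<in> X"
    show "(u, f u) \<in> orel X f' g"
      using off[OF u] dx dy sym' st'[OF u] ffiD[OF f x] ffiD[OF f y] by metis
    show "(u, g u) \<in> orel X f' g" using st'[OF u] by simp
  qed
  have xy': "(x, y) \<in> orel X f' g" using st'[OF x] r by simp
  have C': "(x, u) \<in> orel X f' g" if "u \<in> C" for u
    using that 1 xy' orel_trans unfolding C_def by fast
  have 2: "C \<times> C \<subseteq> orel X f' g" using C' sym' orel_trans by fast
  let ?M = "orel X f g \<union> C \<times> C"
  have M: "equiv X ?M" "card (X // orel X f g) = card (X // ?M) + 1"
    using card_quotient_merge[OF equiv_orel[OF f g] fin x y ap refl] unfolding C_def by auto
  have C4: "x \<in> C" "y \<in> C" "f x \<in> C" "f y \<in> C"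
    using x y st orel_refl[OF x] orel_refl[OF y] unfolding C_def by blast+
  have 3: "orel X f' g \<subseteq> ?M"
  proof (rule orel_least[OF M(1)])
    fix u assume u: "u \<in> X"
    show "(u, f' u) \<in> ?M"
      using off[OF u] st[OF u] C4 r by (cases "u \<in> {x, y, f x, f y}") auto
    show "(u, g u) \<in> ?M" using st[OF u] by simp
  qed
  show eq: "orel X f' g = ?M" using 1 2 3 by blast
  show "card (X // orel X f g) = card (X // orel X f' g) + 1" using M(2) eq by simp
qed

lemma orel_rewire_sub:
  assumes f: "ffi X f" and g: "ffi X g" and rw: "rewires X f f' x y"
    and tog: "(x, y) \<in> orel X f g"
  shows "orel X f' g \<subseteq> orel X f g"
proof (rule orel_least[OF equiv_orel[OF f g]])
  fix u assume u: "u \<in> X"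
  have x: "x \<in> X" and y: "y \<in> X" and r:
     "f' x = y" "f' y = x" "f' (f x) = f y" "f' (f y) = f x"
     and off: "\<And>u. u \<in> X \<Longrightarrow> u \<noteq> x \<Longrightarrow> u \<noteq> y \<Longrightarrow> u \<noteq> f x \<Longrightarrow> u \<noteq> f y \<Longrightarrow> f' u = f u"
    using rw by (auto simp: rewires_def)
  note sym = orel_sym[OF f g]
  note st = orel_step[OF f g]
  have "(f x, f y) \<in> orel X f g"
    using tog st(1)[OF x] st(1)[OF y] sym orel_trans by metis
  then show "(u, f' u) \<in> orel X f g"
    using off[OF u] st[OF u] r sym tog by metis
  show "(u, g u) \<in> orel X f g" using st[OF u] by simp
qed

text \<open>Whether a curve splits depends on the directions in which it passes the two segments,
  which the data do not record. The test is whether \<open>x\<close> still reaches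
  \<open>f x\<close>: if so, the surgery and its inverse both refine, hence nothing changes; if not,
  the inverse merges two curves.\<close>

lemma orel_rewire_together:
  assumes f: "ffi X f" and g: "ffi X g" and fin: "finite X" and rw: "rewires X f f' x y"
    and tog: "(x, y) \<in> orel X f g"
  shows "if (x, f x) \<in> orel X f' g then orel X f' g = orel X f g
         else card (X // orel X f' g) = card (X // orel X f g) + 1"
proof -
  note f' = rewires_ffi[OF f rw] and bk = rewires_back[OF f rw]
  show ?thesis
    using orel_rewire_sub[OF f g rw tog] orel_rewire_sub[OF f' g bk]
      orel_rewire_apart(2)[OF f' g fin bk] by auto
qed

subsection \<open>Boundary components of spanning ribbon subgraphs\<close>

lemma ribbon_graphD:
  assumes "is_ribbon_graph G"
  shows "finite (flags G)" "ffi (flags G) (ribbon_end G)" "ffi (flags G) (ribbon_side G)"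
    "ffi (flags G) (vertex_arc G)"
    "\<And>x. x \<in> flags G \<Longrightarrow> ribbon_end G (ribbon_side G x) = ribbon_side G (ribbon_end G x)"
    "\<And>x. x \<in> flags G \<Longrightarrow> ribbon_side G (ribbon_end G x) \<noteq> x"
  using assms by (auto simp: is_ribbon_graph_def)

definition sub_edge :: "'a ribbon_graph \<Rightarrow> 'a set \<Rightarrow> 'a \<Rightarrow> 'a" where
  "sub_edge G A x = (if x \<in> A then ribbon_side G x else ribbon_end G x)"

abbreviation bd_rel :: "'a ribbon_graph \<Rightarrow> 'a set \<Rightarrow> ('a \<times> 'a) set" where
  "bd_rel G A \<equiv> orel (flags G) (sub_edge G A) (vertex_arc G)"

definition nb :: "'a ribbon_graph \<Rightarrow> 'a set \<Rightarrow> nat" where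
  "nb G A = card (flags G // bd_rel G A)"

text \<open>Edge sets are represented by the unions of their corners, so that membership of a ribbon
  is membership of a corner and complements are set differences.\<close>

definition edge_closed :: "'a ribbon_graph \<Rightarrow> 'a set \<Rightarrow> bool" where
  "edge_closed G A \<longleftrightarrow> A \<subseteq> flags G \<and> (\<forall>x\<in>A. ribbon_end G x \<in> A \<and> ribbon_side G x \<in> A)"

definition edge_at :: "'a ribbon_graph \<Rightarrow> 'a \<Rightarrow> 'a set" where
  "edge_at G x = {x, ribbon_end G x, ribbon_side G x, ribbon_side G (ribbon_end G x)}"

lemma edge_closedD:
  assumes "edge_closed G A" "x \<in> A"
  shows "x \<in> flags G" "ribbon_end G x \<in> A" "ribbon_side G x \<in> A"
  using assms by (auto simp: edge_closed_def)

lemma edge_closed_Un: "edge_closed G A \<Longrightarrow> edge_closed G B \<Longrightarrow> edge_closed G (A \<union> B)"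
  by (auto simp: edge_closed_def)

lemma edge_closed_empty: "edge_closed G {}"
  by (auto simp: edge_closed_def)

locale ribbon_graph =
  fixes G :: "'a ribbon_graph"
  assumes rg: "is_ribbon_graph G"
begin

abbreviation "X \<equiv> flags G"
abbreviation "e \<equiv> ribbon_end G"
abbreviation "s \<equiv> ribbon_side G"
abbreviation "a \<equiv> vertex_arc G"
abbreviation "con \<equiv> bd_rel G"

lemmas finX = ribbon_graphD(1)[OF rg] and ffie = ribbon_graphD(2)[OF rg]
  and ffis = ribbon_graphD(3)[OF rg] and ffia = ribbon_graphD(4)[OF rg]

lemma flagD:
  assumes "x \<in> X"
  shows "e x \<in> X" "e x \<noteq> x" "e (e x) = x" "s x \<in> X" "s x \<noteq> x" "s (s x) = x"
    "a x \<in> X" "a x \<noteq> x" "a (a x) = x" "e (s x) = s (e x)" "s (e x) \<noteq> x" "s x \<noteq> e x"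
proof -
  show 1: "e x \<in> X" "e x \<noteq> x" "e (e x) = x" "s x \<in> X" "s x \<noteq> x" "s (s x) = x"
    "a x \<in> X" "a x \<noteq> x" "a (a x) = x" "e (s x) = s (e x)" "s (e x) \<noteq> x"
    using ffiD[OF ffie assms] ffiD[OF ffis assms] ffiD[OF ffia assms] ribbon_graphD(5,6)[OF rg assms]
    by auto
  show "s x \<noteq> e x" using 1 by metis
qed

lemma edge_closed_flags: "edge_closed G X"
  by (auto simp: edge_closed_def flagD)

lemma edge_closed_Diff:
  assumes "edge_closed G A" "edge_closed G B"
  shows "edge_closed G (A - B)"
  unfolding edge_closed_def
proof (intro conjI ballI)
  show "A - B \<subseteq> X" using assms by (auto simp: edge_closed_def)
next
  fix x assume x: "x \<in> A - B"
  then have xX: "x \<in> X" using assms by (auto simp: edge_closed_def)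
  have "e x \<notin> B" using edge_closedD(2)[OF assms(2), of "e x"] flagD[OF xX] x by auto
  then show "e x \<in> A - B" using x edge_closedD[OF assms(1)] by auto
  have "s x \<notin> B" using edge_closedD(3)[OF assms(2), of "s x"] flagD[OF xX] x by auto
  then show "s x \<in> A - B" using x edge_closedD[OF assms(1)] by auto
qed

lemma edge_closed_edge_at: "x \<in> X \<Longrightarrow> edge_closed G (edge_at G x)"
  unfolding edge_closed_def edge_at_def using flagD[of x] flagD[of "e x"] flagD[of "s x"] by auto

lemma edge_at_self: "x \<in> edge_at G x"
  by (simp add: edge_at_def)

lemma edge_at_subset: "edge_closed G A \<Longrightarrow> x \<in> A \<Longrightarrow> edge_at G x \<subseteq> A"
  by (auto simp: edge_closed_def edge_at_def)

lemma edge_at_eq: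
  assumes "x \<in> X" "y \<in> edge_at G x"
  shows "edge_at G y = edge_at G x"
  using assms(2) flagD[OF assms(1)] flagD[OF flagD(1)[OF assms(1)]] flagD[OF flagD(4)[OF assms(1)]]
  unfolding edge_at_def by auto

lemma edge_at_disjoint:
  assumes "edge_closed G A" "x \<in> X" "x \<notin> A"
  shows "edge_at G x \<inter> A = {}"
proof -
  have "edge_at G x \<subseteq> X - A"
    using assms edge_at_subset[OF edge_closed_Diff[OF edge_closed_flags assms(1)]] by auto
  then show ?thesis by blast
qed

lemma card_edge_at: "x \<in> X \<Longrightarrow> card (edge_at G x) = 4"
proof -
  assume x: "x \<in> X"
  have "s x \<noteq> s (e x)" using flagD[OF x] flagD[OF flagD(1)[OF x]] by metis
  then show ?thesis using flagD[OF x] flagD[OF flagD(1)[OF x]] unfolding edge_at_def by auto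
qed

lemma ffi_sub_edge:
  assumes "edge_closed G A"
  shows "ffi X (sub_edge G A)"
  unfolding fixpoint_free_involution_on_def
proof
  fix x assume x: "x \<in> X"
  show "sub_edge G A x \<in> X \<and> sub_edge G A x \<noteq> x \<and> sub_edge G A (sub_edge G A x) = x"
  proof (cases "x \<in> A")
    case True
    then show ?thesis using flagD[OF x] edge_closedD[OF assms] by (auto simp: sub_edge_def)
  next
    case False
    then have "x \<in> X - A" using x by simp
    then have "e x \<notin> A"
      using edge_closedD(2)[OF edge_closed_Diff[OF edge_closed_flags assms]] by auto
    then show ?thesis using flagD[OF x] False by (auto simp: sub_edge_def)
  qed
qed

lemma equiv_con: "edge_closed G A \<Longrightarrow> equiv X (con A)"
  by (rule equiv_orel[OF ffi_sub_edge ffia])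

lemma con_sym: "edge_closed G A \<Longrightarrow> (x, y) \<in> con A \<Longrightarrow> (y, x) \<in> con A"
  by (rule orel_sym[OF ffi_sub_edge ffia])

lemma con_arc: "edge_closed G A \<Longrightarrow> x \<in> X \<Longrightarrow> (x, a x) \<in> con A"
  by (rule orel_step(2)[OF ffi_sub_edge ffia])

lemma con_side: "edge_closed G A \<Longrightarrow> x \<in> A \<Longrightarrow> (x, s x) \<in> con A"
  using orel_step(1)[OF ffi_sub_edge ffia, of A x] edge_closedD(1)[of G A x]
  by (auto simp: sub_edge_def)

lemma con_end: "edge_closed G A \<Longrightarrow> x \<in> X \<Longrightarrow> x \<notin> A \<Longrightarrow> (x, e x) \<in> con A"
  using orel_step(1)[OF ffi_sub_edge ffia, of A x] by (auto simp: sub_edge_def)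

text \<open>Adding a ribbon exchanges its two ends for its two sides. Hence \<open>x\<close> and
  \<open>s x\<close> decide about an addition, \<open>x\<close> and \<open>e x\<close> about a
  deletion.\<close>

lemma rewires_add_edge:
  assumes "edge_closed G A" "x \<in> X" "x \<notin> A"
  shows "rewires X (sub_edge G A) (sub_edge G (A \<union> edge_at G x)) x (s x)"
proof -
  note D = flagD[OF assms(2)] and Ds = flagD[OF flagD(4)[OF assms(2)]] and
    De = flagD[OF flagD(1)[OF assms(2)]]
  have d: "e x \<notin> A" "s x \<notin> A" "s (e x) \<notin> A"
    using edge_at_disjoint[OF assms] by (auto simp: edge_at_def)
  have 1: "sub_edge G A x = e x" "sub_edge G A (s x) = s (e x)"
    "sub_edge G (A \<union> edge_at G x) x = s x" "sub_edge G (A \<union> edge_at G x) (s x) = x"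
    "sub_edge G (A \<union> edge_at G x) (e x) = s (e x)" "sub_edge G (A \<union> edge_at G x) (s (e x)) = e x"
    using assms d D Ds De by (simp_all add: sub_edge_def edge_at_def)
  have 2: "sub_edge G (A \<union> edge_at G x) u = sub_edge G A u"
    if "u \<noteq> x" "u \<noteq> s x" "u \<noteq> e x" "u \<noteq> s (e x)" for u
    using that by (simp add: sub_edge_def edge_at_def)
  show ?thesis unfolding rewires_def using assms(2) 1 2 D by auto
qed

lemma add_edge_apart:
  assumes "edge_closed G A" "x \<in> X" "x \<notin> A" "(x, s x) \<notin> con A"
  shows "nb G A = nb G (A \<union> edge_at G x) + 1"
  using orel_rewire_apart(2)[OF ffi_sub_edge[OF assms(1)] ffia finX rewires_add_edge[OF assms(1-3)] assms(4)]
  by (simp add: nb_def)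

lemma add_edge_together:
  assumes "edge_closed G A" "x \<in> X" "x \<notin> A" "(x, s x) \<in> con A"
  shows "nb G A \<le> nb G (A \<union> edge_at G x)"
    and "nb G (A \<union> edge_at G x) \<le> nb G A + 1"
    and "(x, e x) \<in> con (A \<union> edge_at G x) \<Longrightarrow> con (A \<union> edge_at G x) = con A"
  using orel_rewire_together[OF ffi_sub_edge[OF assms(1)] ffia finX rewires_add_edge[OF assms(1-3)] assms(4)]
    assms(3) by (auto simp: nb_def sub_edge_def split: if_splits)

lemma add_edge_le:
  assumes "edge_closed G A" "x \<in> X" "x \<notin> A"
  shows "nb G (A \<union> edge_at G x) \<le> nb G A + 1"
  using add_edge_apart[OF assms] add_edge_together(2)[OF assms] by linarith

text \<open>The explicit form of \<open>con A\<close> is needed later to locate the corners of a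
  second loop after a first one has been deleted.\<close>

lemma remove_edge_apart:
  assumes A: "edge_closed G A" "x \<in> X" "x \<notin> A" and ap: "(x, e x) \<notin> con (A \<union> edge_at G x)"
  shows "nb G (A \<union> edge_at G x) = nb G A + 1"
    and "con A = con (A \<union> edge_at G x) \<union>
           (con (A \<union> edge_at G x) `` {x, e x}) \<times> (con (A \<union> edge_at G x) `` {x, e x})"
proof -
  have cl: "edge_closed G (A \<union> edge_at G x)" by (intro edge_closed_Un A edge_closed_edge_at)
  have rw: "rewires X (sub_edge G (A \<union> edge_at G x)) (sub_edge G A) x (e x)"
    using rewires_back[OF ffi_sub_edge[OF A(1)] rewires_add_edge[OF A]] A(3)
    by (simp add: sub_edge_def)
  show "nb G (A \<union> edge_at G x) = nb G A + 1"
    "con A = con (A \<union> edge_at G x) \<union>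
       (con (A \<union> edge_at G x) `` {x, e x}) \<times> (con (A \<union> edge_at G x) `` {x, e x})"
    using orel_rewire_apart[OF ffi_sub_edge[OF cl] ffia finX rw ap] by (simp_all add: nb_def)
qed

text \<open>The deletion splits a component or changes nothing; equal counts exclude the
  split.\<close>

lemma remove_edge_together:
  assumes A: "edge_closed G A" "x \<in> X" "x \<notin> A" and tog: "(x, e x) \<in> con (A \<union> edge_at G x)"
  shows "nb G (A \<union> edge_at G x) \<le> nb G A"
    and "nb G (A \<union> edge_at G x) = nb G A \<Longrightarrow> con (A \<union> edge_at G x) = con A"
proof -
  have cl: "edge_closed G (A \<union> edge_at G x)" by (intro edge_closed_Un A edge_closed_edge_at)
  have rw: "rewires X (sub_edge G (A \<union> edge_at G x)) (sub_edge G A) x (e x)"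
    using rewires_back[OF ffi_sub_edge[OF A(1)] rewires_add_edge[OF A]] A(3)
    by (simp add: sub_edge_def)
  note tg = orel_rewire_together[OF ffi_sub_edge[OF cl] ffia finX rw tog]
  show "nb G (A \<union> edge_at G x) \<le> nb G A"
    "nb G (A \<union> edge_at G x) = nb G A \<Longrightarrow> con (A \<union> edge_at G x) = con A"
    using tg by (auto simp: nb_def split: if_splits)
qed

end

subsection \<open>The polynomial in terms of boundary components\<close>

context ribbon_graph
begin

lemma edges_eq: "edges G = edge_at G ` X"
proof -
  have "orel X e s `` {x} = edge_at G x" if x: "x \<in> X" for x
  proof
    show "orel X e s `` {x} \<subseteq> edge_at G x"
    proof
      fix y assume "y \<in> orel X e s `` {x}"
      then have "(x, y) \<in> orel X e s" by simp
      then show "y \<in> edge_at G x"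
        by (rule orel_closed) (use edge_closedD[OF edge_closed_edge_at[OF x]] edge_at_self in auto)
    qed
    note st = orel_step[OF ffie ffis]
    have "(x, s (e x)) \<in> orel X e s"
      using orel_trans[OF st(1)[OF x] st(2)[OF flagD(1)[OF x]]] .
    then show "edge_at G x \<subseteq> orel X e s `` {x}"
      using st[OF x] orel_refl[OF x] by (auto simp: edge_at_def)
  qed
  then show ?thesis
    unfolding edges_def orbits_eq_quotient[OF ffie ffis] quotient_def by auto
qed

lemma finite_edges: "finite (edges G)"
  by (simp add: edges_eq finX)

lemma card_flags: "card X = 4 * card (edges G)"
proof -
  have U: "\<Union>(edges G) = X"
    using edge_at_self edge_at_subset[OF edge_closed_flags] by (auto simp: edges_eq)
  have "4 * card (edges G) = card (\<Union>(edges G))"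
  proof (rule card_partition)
    show "finite (\<Union>(edges G))" using U finX by simp
    fix c1 c2 assume "c1 \<in> edges G" "c2 \<in> edges G" "c1 \<noteq> c2"
    then show "c1 \<inter> c2 = {}" using edge_at_eq unfolding edges_eq by blast
  qed (use finite_edges card_edge_at in \<open>auto simp: edges_eq\<close>)
  then show ?thesis using U by simp
qed

lemma edge_closed_Union: "\<A> \<subseteq> edges G \<Longrightarrow> edge_closed G (\<Union>\<A>)"
  using edge_closedD[OF edge_closed_edge_at] unfolding edges_eq edge_closed_def by blast

lemma edge_closed_eq_Union:
  assumes "edge_closed G A"
  shows "\<exists>\<A>\<subseteq>edges G. A = \<Union>\<A>"
proof (intro exI conjI)
  show "edge_at G ` A \<subseteq> edges G" using assms by (auto simp: edges_eq edge_closed_def)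
  show "A = \<Union>(edge_at G ` A)" using edge_at_self edge_at_subset[OF assms] by blast
qed

lemma vertices_eq: "card (vertices G) = nb G {}"
proof -
  have "sub_edge G {} = e" by (auto simp: sub_edge_def)
  then show ?thesis unfolding vertices_def nb_def orbits_eq_quotient[OF ffie ffia] by simp
qed

text \<open>Each ribbon adds at most one component, and four corners make one ribbon. Applied to a
  set and its complement this bounds the sum by \<open>card (edges G) + 2\<close> for a bouquet, so
  the genus of a partial dual is nonnegative and \<open>nat\<close> is harmless.\<close>

lemma nb_le:
  assumes "edge_closed G A"
  shows "4 * nb G A \<le> 4 * nb G {} + card A"
  using assms
proof (induction "card A" arbitrary: A rule: less_induct)
  case less
  show ?case
  proof (cases "A = {}")
    case False
    then obtain x where x: "x \<in> A" by blast
    have xX: "x \<in> X" using edge_closedD(1)[OF less.prems x] .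
    let ?A = "A - edge_at G x"
    have sub: "edge_at G x \<subseteq> A" using edge_at_subset[OF less.prems x] .
    have cl: "edge_closed G ?A" by (intro edge_closed_Diff less.prems edge_closed_edge_at xX)
    have fin: "finite A" using less.prems finX by (auto simp: edge_closed_def dest: finite_subset)
    have c: "card A = card ?A + 4"
      using card_Diff_subset[OF finite_subset[OF sub fin] sub] card_mono[OF fin sub] card_edge_at[OF xX]
      by simp
    have "nb G (?A \<union> edge_at G x) \<le> nb G ?A + 1"
      by (rule add_edge_le[OF cl xX]) (simp add: edge_at_self)
    moreover have "?A \<union> edge_at G x = A" using sub by blast
    moreover have "4 * nb G ?A \<le> 4 * nb G {} + card ?A" by (rule less.hyps) (use c cl in auto)
    ultimately show ?thesis using c by simp
  qed simp
qed

text \<open>The dual interchanges ends and sides on \<open>\<A>\<close> only. Its vertices are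
  therefore the boundary curves of \<open>\<A>\<close>, its boundary components those of the
  complement, and its edges are unchanged.\<close>

lemma euler_genus_partial_dual:
  assumes "\<A> \<subseteq> edges G"
  shows "euler_genus (partial_dual G \<A>) =
    2 + int (card (edges G)) - int (nb G (\<Union>\<A>) + nb G (X - \<Union>\<A>))"
proof -
  let ?A = "\<Union>\<A>"
  have cl: "edge_closed G ?A" "edge_closed G (X - ?A)"
    using edge_closed_Union[OF assms] edge_closed_Diff[OF edge_closed_flags] by auto
  have f: "flags (partial_dual G \<A>) = X" "vertex_arc (partial_dual G \<A>) = a"
    by (simp_all add: partial_dual_def)
  have e: "ribbon_end (partial_dual G \<A>) = sub_edge G ?A"
    by (auto simp: partial_dual_def sub_edge_def)
  \<comment> \<open>Restricted to corners: a point outside \<open>X\<close> belongs neither to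
    \<open>?A\<close> nor to \<open>X - ?A\<close>, and there the two functions take different
    branches.\<close>
  have s: "ribbon_side (partial_dual G \<A>) x = sub_edge G (X - ?A) x" if "x \<in> X" for x
    using that by (auto simp: partial_dual_def sub_edge_def)
  have "orbits X (ribbon_side (partial_dual G \<A>)) a = orbits X (sub_edge G (X - ?A)) a"
  proof -
    have "{(x, y). x \<in> X \<and> (y = ribbon_side (partial_dual G \<A>) x \<or> y = a x)} =
          {(x, y). x \<in> X \<and> (y = sub_edge G (X - ?A) x \<or> y = a x)}"
      using s by auto
    then show ?thesis by (simp add: orbits_def)
  qed
  then have b: "card (boundary_components (partial_dual G \<A>)) = nb G (X - ?A)"
    using orbits_eq_quotient[OF ffi_sub_edge[OF cl(2)] ffia]
    by (simp add: boundary_components_def f nb_def)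
  have v: "card (vertices (partial_dual G \<A>)) = nb G ?A"
    using orbits_eq_quotient[OF ffi_sub_edge[OF cl(1)] ffia]
    by (simp add: vertices_def f e nb_def)
  have "(y = ribbon_end (partial_dual G \<A>) x \<or> y = ribbon_side (partial_dual G \<A>) x) \<longleftrightarrow>
      (y = e x \<or> y = s x)" for x y
    by (cases "x \<in> ?A") (auto simp: partial_dual_def simp del: Union_iff)
  then have "edges (partial_dual G \<A>) = edges G"
    by (simp add: edges_def orbits_def f)
  then show ?thesis using b v by (simp add: euler_genus_def)
qed

end

definition const_sum :: "'a ribbon_graph \<Rightarrow> nat \<Rightarrow> bool" where
  "const_sum G c \<longleftrightarrow> (\<forall>A. edge_closed G A \<longrightarrow> nb G A + nb G (flags G - A) = c)"

text \<open>The coefficient at \<open>b\<close> counts the members of \<open>S\<close> with exponent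
  \<open>b\<close>; it reaches \<open>card S\<close> only if all of them have it.\<close>

lemma sum_monom_eq_iff:
  fixes k :: "'b \<Rightarrow> nat"
  assumes "finite S"
  shows "(\<Sum>A\<in>S. monom (1::int) (k A)) = monom (int (card S)) b \<longleftrightarrow> (\<forall>A\<in>S. k A = b)"
proof
  assume eq: "(\<Sum>A\<in>S. monom (1::int) (k A)) = monom (int (card S)) b"
  have "int (card {A\<in>S. k A = b}) = (\<Sum>A\<in>S. if k A = b then 1 else 0)"
    using assms by (simp add: sum.If_cases Int_def)
  also have "\<dots> = coeff (\<Sum>A\<in>S. monom (1::int) (k A)) b"
    by (simp add: coeff_sum)
  also have "\<dots> = int (card S)" by (simp add: eq)
  finally have "card {A\<in>S. k A = b} = card S" by simp
  then have "{A\<in>S. k A = b} = S" using assms by (intro card_subset_eq) auto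
  then show "\<forall>A\<in>S. k A = b" by auto
next
  assume "\<forall>A\<in>S. k A = b"
  then have "(\<Sum>A\<in>S. monom (1::int) (k A)) = (\<Sum>A\<in>S. monom 1 b)" by (intro sum.cong) auto
  also have "\<dots> = monom (int (card S)) b"
    by (rule poly_eqI, subst coeff_sum) simp
  finally show "(\<Sum>A\<in>S. monom (1::int) (k A)) = monom (int (card S)) b" .
qed

text \<open>All exponents are \<open>b\<close> iff all sums are
  \<open>card (edges G) + 2 - b\<close>; the additive form avoids truncated subtraction.\<close>

lemma partial_dual_genus_poly_monom_iff:
  assumes "is_bouquet G"
  shows "partial_dual_genus_poly G = monom (2 ^ card (edges G)) b \<longleftrightarrow>
    (\<exists>c. const_sum G c \<and> b + c = card (edges G) + 2)"
proof -
  interpret ribbon_graph G using assms by unfold_locales (simp add: is_bouquet_def)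
  let ?n = "card (edges G)"
  have nb0: "nb G {} = 1" using assms vertices_eq by (simp add: is_bouquet_def)
  have bound: "nb G A + nb G (X - A) \<le> ?n + 2" if cl: "edge_closed G A" for A
  proof -
    have AX: "A \<subseteq> X" using cl by (simp add: edge_closed_def)
    have "card (X - A) + card A = 4 * ?n"
      using card_Diff_subset[OF finite_subset[OF AX finX] AX] card_mono[OF finX AX] card_flags by simp
    then show ?thesis
      using nb_le[OF cl] nb_le[OF edge_closed_Diff[OF edge_closed_flags cl]] nb0 by simp
  qed
  have k: "nat (euler_genus (partial_dual G \<A>)) = b \<longleftrightarrow>
      b + (nb G (\<Union>\<A>) + nb G (X - \<Union>\<A>)) = ?n + 2" if "\<A> \<subseteq> edges G" for \<A>
    using euler_genus_partial_dual[OF that] bound[OF edge_closed_Union[OF that]] by auto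
  have "partial_dual_genus_poly G = monom (2 ^ ?n) b \<longleftrightarrow>
     (\<forall>\<A>\<in>Pow (edges G). nat (euler_genus (partial_dual G \<A>)) = b)"
    using sum_monom_eq_iff[of "Pow (edges G)"] finite_edges
    by (simp add: partial_dual_genus_poly_def card_Pow)
  also have "\<dots> \<longleftrightarrow> (\<forall>\<A>. \<A> \<subseteq> edges G \<longrightarrow> b + (nb G (\<Union>\<A>) + nb G (X - \<Union>\<A>)) = ?n + 2)"
    using k by auto
  also have "\<dots> \<longleftrightarrow> (\<forall>A. edge_closed G A \<longrightarrow> b + (nb G A + nb G (X - A)) = ?n + 2)"
    using edge_closed_Union edge_closed_eq_Union by metis
  also have "\<dots> \<longleftrightarrow> (\<exists>c. const_sum G c \<and> b + c = ?n + 2)"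
  proof
    assume L: "\<forall>A. edge_closed G A \<longrightarrow> b + (nb G A + nb G (X - A)) = ?n + 2"
    then have "const_sum G (?n + 2 - b)"
      unfolding const_sum_def by (metis add_diff_cancel_left')
    moreover have "b \<le> ?n + 2" using L edge_closed_empty by (metis le_add1)
    ultimately show "\<exists>c. const_sum G c \<and> b + c = ?n + 2" by (intro exI[of _ "?n + 2 - b"]) simp
  next
    assume "\<exists>c. const_sum G c \<and> b + c = ?n + 2"
    then show "\<forall>A. edge_closed G A \<longrightarrow> b + (nb G A + nb G (X - A)) = ?n + 2"
      by (auto simp: const_sum_def)
  qed
  finally show ?thesis .
qed

subsection \<open>Equivalence and ribbon-joins\<close>

lemma orel_image:
  assumes bij: "bij_betw \<phi> X Y" and ff: "ffi X f" "ffi X g"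
    and f: "\<And>x. x \<in> X \<Longrightarrow> \<phi> (f x) = f' (\<phi> x)" and g: "\<And>x. x \<in> X \<Longrightarrow> \<phi> (g x) = g' (\<phi> x)"
  shows "card (X // orel X f g) = card (Y // orel Y f' g')"
proof -
  have inj: "inj_on \<phi> X" and im: "\<phi> ` X = Y" using bij by (auto simp: bij_betw_def)
  have mem: "f x \<in> X" "g x \<in> X" if "x \<in> X" for x using that ffiD[OF ff(1)] ffiD[OF ff(2)] by auto
  have ffY: "ffi Y k'" if k: "ffi X k" "\<And>x. x \<in> X \<Longrightarrow> \<phi> (k x) = k' (\<phi> x)" for k k'
    unfolding fixpoint_free_involution_on_def
  proof
    fix y assume "y \<in> Y"
    then obtain x where x: "x \<in> X" "y = \<phi> x" using im by auto
    note kx = ffiD[OF k(1) x(1)]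
    have "\<phi> (k x) \<noteq> \<phi> x" using kx x(1) inj by (auto dest: inj_onD)
    then show "k' y \<in> Y \<and> k' y \<noteq> y \<and> k' (k' y) = y"
      using k(2)[OF x(1)] k(2)[OF kx(1)] kx x im by (metis imageI)
  qed
  note ff' = ffY[OF ff(1) f] ffY[OF ff(2) g]
  have im_class: "\<phi> ` (orel X f g `` {x}) = orel Y f' g' `` {\<phi> x}" if x: "x \<in> X" for x
  proof (intro equalityI subsetI)
    fix y assume "y \<in> \<phi> ` (orel X f g `` {x})"
    then obtain z where z: "(x, z) \<in> orel X f g" "y = \<phi> z" by auto
    have "z \<in> {z \<in> X. (\<phi> x, \<phi> z) \<in> orel Y f' g'}"
    proof (rule orel_closed[OF z(1)])
      show "x \<in> {z \<in> X. (\<phi> x, \<phi> z) \<in> orel Y f' g'}" using x im by (auto intro!: orel_refl)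
    next
      fix z assume "z \<in> {z \<in> X. (\<phi> x, \<phi> z) \<in> orel Y f' g'}"
      then have z: "z \<in> X" "\<phi> z \<in> Y" "(\<phi> x, \<phi> z) \<in> orel Y f' g'" using im by auto
      show "f z \<in> {z \<in> X. (\<phi> x, \<phi> z) \<in> orel Y f' g'}" "g z \<in> {z \<in> X. (\<phi> x, \<phi> z) \<in> orel Y f' g'}"
        using mem[OF z(1)] f[OF z(1)] g[OF z(1)] orel_trans[OF z(3)] orel_step[OF ff' z(2)] by auto
    qed
    then show "y \<in> orel Y f' g' `` {\<phi> x}" using z by simp
  next
    fix y assume "y \<in> orel Y f' g' `` {\<phi> x}"
    then have "(\<phi> x, y) \<in> orel Y f' g'" by simp
    then show "y \<in> \<phi> ` (orel X f g `` {x})"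
    proof (rule orel_closed)
      show "\<phi> x \<in> \<phi> ` (orel X f g `` {x})" using x by (auto intro!: orel_refl)
    next
      fix w assume "w \<in> \<phi> ` (orel X f g `` {x})"
      then obtain z where z: "(x, z) \<in> orel X f g" "w = \<phi> z" by auto
      then have zX: "z \<in> X" using orel_dom[OF z(1)] by simp
      show "f' w \<in> \<phi> ` (orel X f g `` {x})" "g' w \<in> \<phi> ` (orel X f g `` {x})"
        using f[OF zX] g[OF zX] orel_trans[OF z(1)] orel_step[OF ff zX] z(2) by (metis Image_singleton_iff imageI)+
    qed
  qed
  have "(`) \<phi> ` (X // orel X f g) = Y // orel Y f' g'"
    using im im_class unfolding quotient_def by (auto simp: image_iff)
  moreover have "inj_on ((`) \<phi>) (X // orel X f g)"
    using inj by (intro inj_onI) (metis (no_types, lifting) inj_on_image_eq_iff in_quotient_imp_subset equiv_orel[OF ff])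
  ultimately show ?thesis by (metis card_image)
qed

lemma const_sum_equiv_imp:
  assumes "is_ribbon_graph G" "ribbon_equiv G H" "const_sum H c"
  shows "const_sum G c"
  unfolding const_sum_def
proof (intro allI impI)
  interpret ribbon_graph G by unfold_locales fact
  fix A assume A: "edge_closed G A"
  obtain \<phi> where bij: "bij_betw \<phi> X (flags H)" and c: "\<And>x. x \<in> X \<Longrightarrow> \<phi> (e x) = ribbon_end H (\<phi> x)"
    "\<And>x. x \<in> X \<Longrightarrow> \<phi> (s x) = ribbon_side H (\<phi> x)" "\<And>x. x \<in> X \<Longrightarrow> \<phi> (a x) = vertex_arc H (\<phi> x)"
    using assms(2) unfolding ribbon_equiv_def by blast
  have inj: "inj_on \<phi> X" and im: "\<phi> ` X = flags H" using bij by (auto simp: bij_betw_def)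
  have nb: "nb G A = nb H (\<phi> ` A)" if A: "edge_closed G A" for A
    unfolding nb_def
  proof (rule orel_image[OF bij ffi_sub_edge[OF A] ffia])
    fix x assume x: "x \<in> X"
    have "\<phi> x \<in> \<phi> ` A \<longleftrightarrow> x \<in> A" using A x inj by (auto simp: edge_closed_def inj_on_def)
    then show "\<phi> (sub_edge G A x) = sub_edge H (\<phi> ` A) (\<phi> x)" using c[OF x] by (simp add: sub_edge_def)
  qed (use c in auto)
  have AX: "A \<subseteq> X" using A by (simp add: edge_closed_def)
  have cl: "edge_closed H (\<phi> ` A)"
    unfolding edge_closed_def
  proof (intro conjI ballI)
    show "\<phi> ` A \<subseteq> flags H" using AX im by auto
    fix y assume "y \<in> \<phi> ` A"
    then obtain x where x: "x \<in> A" "y = \<phi> x" by auto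
    then show "ribbon_end H y \<in> \<phi> ` A" "ribbon_side H y \<in> \<phi> ` A"
      using c[of x] edge_closedD[OF A x(1)] by (metis imageI)+
  qed
  have "\<phi> ` (X - A) = flags H - \<phi> ` A" using inj im AX by (simp add: inj_on_image_set_diff)
  then show "nb G A + nb G (X - A) = c"
    using nb[OF A] nb[OF edge_closed_Diff[OF edge_closed_flags A]] assms(3) cl
    by (simp add: const_sum_def)
qed

section \<open>Ribbon-joins and the behaviour of \<open>nb\<close> under them\<close>

lemma orel_commute: "orel X f g = orel X g f"
  by (simp add: orel_def disj_commute)

lemma orel_disjoint:
  assumes XY: "X \<inter> Y = {}" "finite X" "finite Y"
    and ff: "ffi X f" "ffi X g" "ffi Y f" "ffi Y g"
  shows "card ((X \<union> Y) // orel (X \<union> Y) f g) = card (X // orel X f g) + card (Y // orel Y f g)"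
    and "x \<in> X \<Longrightarrow> y \<in> Y \<Longrightarrow> (x, y) \<notin> orel (X \<union> Y) f g"
proof -
  have cls: "orel (V \<union> W) f g `` {x} = orel V f g `` {x}"
    if x: "x \<in> V" and fV: "ffi V f" "ffi V g" for V W and x
  proof (intro equalityI subsetI)
    fix y assume "y \<in> orel (V \<union> W) f g `` {x}"
    then have "(x, y) \<in> orel (V \<union> W) f g" by simp
    then have "y \<in> {z \<in> V. (x, z) \<in> orel V f g}"
    proof (rule orel_closed)
      show "x \<in> {z \<in> V. (x, z) \<in> orel V f g}" using x by (auto intro: orel_refl)
    next
      fix z assume "z \<in> {z \<in> V. (x, z) \<in> orel V f g}"
      then have z: "z \<in> V" "(x, z) \<in> orel V f g" by auto
      show "f z \<in> {z \<in> V. (x, z) \<in> orel V f g}" "g z \<in> {z \<in> V. (x, z) \<in> orel V f g}"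
        using orel_trans[OF z(2)] orel_step[OF fV z(1)] ffiD[OF fV(1) z(1)] ffiD[OF fV(2) z(1)] by auto
    qed
    then show "y \<in> orel V f g `` {x}" by simp
  next
    fix y assume "y \<in> orel V f g `` {x}"
    then have xy: "(x, y) \<in> {(x, y). x \<in> V \<and> (y = f x \<or> y = g x)}\<^sup>*" "y \<in> V" by (auto simp: orel_def)
    have "{(x, y). x \<in> V \<and> (y = f x \<or> y = g x)}\<^sup>* \<subseteq> {(x, y). x \<in> V \<union> W \<and> (y = f x \<or> y = g x)}\<^sup>*"
      by (rule rtrancl_mono) auto
    then show "y \<in> orel (V \<union> W) f g `` {x}" using xy x by (auto simp: orel_def)
  qed
  have clY: "orel (X \<union> Y) f g `` {y} = orel Y f g `` {y}" if "y \<in> Y" for y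
    using cls[OF that ff(3,4), of X] by (simp add: Un_commute)
  note clX = cls[OF _ ff(1,2), of _ Y]
  have eq: "(X \<union> Y) // orel (X \<union> Y) f g = X // orel X f g \<union> Y // orel Y f g"
    using clX clY unfolding quotient_def by auto
  have sub: "K \<subseteq> V \<and> K \<noteq> {}" if "K \<in> V // orel V f g" "ffi V f" "ffi V g" for K V
    using that in_quotient_imp_subset in_quotient_imp_non_empty equiv_orel by metis
  have "X // orel X f g \<inter> Y // orel Y f g = {}"
    using sub[of _ X] sub[of _ Y] ff XY(1) by blast
  moreover have "finite (X // orel X f g)" "finite (Y // orel Y f g)"
    using XY by (auto intro!: finite_quotient simp: orel_def)
  ultimately show "card ((X \<union> Y) // orel (X \<union> Y) f g) = card (X // orel X f g) + card (Y // orel Y f g)"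
    unfolding eq by (rule card_Un_disjoint[rotated 2])
  show "(x, y) \<notin> orel (X \<union> Y) f g" if "x \<in> X" "y \<in> Y"
    using clX[OF that(1)] that(2) XY(1) by (auto dest: orel_dom)
qed

locale join_setup = P: ribbon_graph P + Q: ribbon_graph Q for P Q :: "'a ribbon_graph" +
  fixes x y :: 'a
  assumes disj: "flags P \<inter> flags Q = {}" and xP: "x \<in> flags P" and yQ: "y \<in> flags Q"
begin

abbreviation "J \<equiv> ribbon_join P x Q y"

text \<open>The arcs of the disjoint union before pasting; the join is a single surgery on them at
  \<open>x\<close> and \<open>y\<close>.\<close>

definition "arc0 z = (if z \<in> flags P then vertex_arc P z else vertex_arc Q z)"

lemma flags_J: "flags J = flags P \<union> flags Q"
  by (simp add: ribbon_join_def)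

lemma inP: "z \<in> flags P \<Longrightarrow> z \<notin> flags Q"
  using disj by auto

lemma endJ: "z \<in> flags P \<Longrightarrow> ribbon_end J z = ribbon_end P z" "z \<in> flags Q \<Longrightarrow> ribbon_end J z = ribbon_end Q z"
  and sideJ: "z \<in> flags P \<Longrightarrow> ribbon_side J z = ribbon_side P z" "z \<in> flags Q \<Longrightarrow> ribbon_side J z = ribbon_side Q z"
  using disj by (auto simp: ribbon_join_def)

lemma arc0: "z \<in> flags P \<Longrightarrow> arc0 z = vertex_arc P z" "z \<in> flags Q \<Longrightarrow> arc0 z = vertex_arc Q z"
  using disj by (auto simp: arc0_def)

lemma ffi_arc0: "ffi (flags P) arc0" "ffi (flags Q) arc0" "ffi (flags J) arc0"
  using P.flagD Q.flagD arc0 unfolding fixpoint_free_involution_on_def flags_J by auto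

lemma rewires_join: "rewires (flags J) arc0 (vertex_arc J) x y"
  unfolding rewires_def flags_J arc0(1)[OF xP] arc0(2)[OF yQ]
  using xP yQ P.flagD[OF xP] Q.flagD[OF yQ] inP inP[OF xP] inP[OF P.flagD(7)[OF xP]]
  by (auto simp: ribbon_join_def arc0_def)

lemma ffi_arc_J: "ffi (flags J) (vertex_arc J)"
  by (rule rewires_ffi[OF ffi_arc0(3) rewires_join])

lemma is_ribbon_graph_J: "is_ribbon_graph J"
proof -
  have "ffi (flags J) (ribbon_end J)" "ffi (flags J) (ribbon_side J)"
    using P.flagD Q.flagD endJ sideJ unfolding fixpoint_free_involution_on_def flags_J by auto
  moreover have "\<forall>z\<in>flags J. ribbon_end J (ribbon_side J z) = ribbon_side J (ribbon_end J z) \<and>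
                  ribbon_end J (ribbon_side J z) \<noteq> z"
    using P.flagD Q.flagD endJ sideJ unfolding flags_J by auto
  ultimately show ?thesis
    using ffi_arc_J P.finX Q.finX unfolding is_ribbon_graph_def flags_J by blast
qed

lemma edge_closed_J:
  "edge_closed J A \<longleftrightarrow> A \<subseteq> flags P \<union> flags Q \<and> edge_closed P (A \<inter> flags P) \<and> edge_closed Q (A \<inter> flags Q)"
proof
  assume A: "edge_closed J A"
  then have sub: "A \<subseteq> flags P \<union> flags Q" by (simp add: edge_closed_def flags_J)
  moreover have "edge_closed P (A \<inter> flags P)"
    unfolding edge_closed_def using edge_closedD[OF A] endJ(1) sideJ(1) P.flagD by (metis IntE IntI inf_le2)
  moreover have "edge_closed Q (A \<inter> flags Q)"
    unfolding edge_closed_def using edge_closedD[OF A] endJ(2) sideJ(2) Q.flagD by (metis IntE IntI inf_le2)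
  ultimately show "A \<subseteq> flags P \<union> flags Q \<and> edge_closed P (A \<inter> flags P) \<and> edge_closed Q (A \<inter> flags Q)"
    by blast
next
  assume "A \<subseteq> flags P \<union> flags Q \<and> edge_closed P (A \<inter> flags P) \<and> edge_closed Q (A \<inter> flags Q)"
  then show "edge_closed J A"
    unfolding edge_closed_def flags_J using endJ sideJ by (metis IntE IntI UnE subsetD)
qed

text \<open>In the disjoint union the counts add up. The corners \<open>x\<close> and
  \<open>y\<close> lie on curves of different summands whatever \<open>A\<close> is, so pasting
  always merges exactly two curves.\<close>

lemma nb_join:
  assumes A: "edge_closed J A"
  shows "nb J A + 1 = nb P (A \<inter> flags P) + nb Q (A \<inter> flags Q)"
proof -
  interpret J: ribbon_graph J by unfold_locales (rule is_ribbon_graph_J)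
  note clP = A[unfolded edge_closed_J, THEN conjunct2, THEN conjunct1]
    and clQ = A[unfolded edge_closed_J, THEN conjunct2, THEN conjunct2]
  have fP: "sub_edge J A z = sub_edge P (A \<inter> flags P) z" if "z \<in> flags P" for z
    using that by (simp add: sub_edge_def endJ sideJ)
  have fQ: "sub_edge J A z = sub_edge Q (A \<inter> flags Q) z" if "z \<in> flags Q" for z
    using that by (simp add: sub_edge_def endJ sideJ)
  have ffP: "ffi (flags P) (sub_edge J A)" and ffQ: "ffi (flags Q) (sub_edge J A)"
    using P.ffi_sub_edge[OF clP] Q.ffi_sub_edge[OF clQ] fP fQ
    unfolding fixpoint_free_involution_on_def by metis+
  note dj = orel_disjoint[OF disj P.finX Q.finX ffP ffi_arc0(1) ffQ ffi_arc0(2), folded flags_J]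
  have 1: "orel (flags P) (sub_edge J A) arc0 = bd_rel P (A \<inter> flags P)"
    by (rule orel_cong) (use fP arc0 in auto)
  have 2: "orel (flags Q) (sub_edge J A) arc0 = bd_rel Q (A \<inter> flags Q)"
    by (rule orel_cong) (use fQ arc0 in auto)
  have "(x, y) \<notin> orel (flags J) arc0 (sub_edge J A)"
    using dj(2)[OF xP yQ] by (simp add: orel_commute)
  then have "card (flags J // orel (flags J) (sub_edge J A) arc0) = nb J A + 1"
    using orel_rewire_apart(2)[OF ffi_arc0(3) J.ffi_sub_edge[OF A] J.finX rewires_join]
    by (simp add: nb_def orel_commute)
  then show ?thesis using dj(1) unfolding 1 2 by (simp add: nb_def)
qed

text \<open>The loss of one component occurs both for \<open>A\<close> and for its complement, hence
  the 2.\<close>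

lemma const_sum_join:
  assumes "const_sum P c" "const_sum Q d"
  shows "const_sum J (c + d - 2)"
  unfolding const_sum_def
proof (intro allI impI)
  interpret J: ribbon_graph J by unfold_locales (rule is_ribbon_graph_J)
  fix A assume A: "edge_closed J A"
  have "(flags J - A) \<inter> flags P = flags P - A \<inter> flags P" "(flags J - A) \<inter> flags Q = flags Q - A \<inter> flags Q"
    by (auto simp: flags_J)
  moreover have "nb P (A \<inter> flags P) + nb P (flags P - A \<inter> flags P) = c"
    "nb Q (A \<inter> flags Q) + nb Q (flags Q - A \<inter> flags Q) = d"
    using assms A unfolding edge_closed_J const_sum_def by simp_all
  ultimately show "nb J A + nb J (flags J - A) = c + d - 2"
    using nb_join[OF A] nb_join[OF J.edge_closed_Diff[OF J.edge_closed_flags A]] by simp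
qed

lemma const_sum_join_factors:
  assumes "const_sum J c"
  shows "\<exists>d. const_sum P d" "\<exists>d. const_sum Q d"
proof -
  interpret J: ribbon_graph J by unfold_locales (rule is_ribbon_graph_J)
  have key: "nb P (A \<inter> flags P) + nb Q (A \<inter> flags Q) + (nb P (flags P - A) + nb Q (flags Q - A)) = c + 2"
    if A: "edge_closed J A" for A
  proof -
    have "(flags J - A) \<inter> flags P = flags P - A" "(flags J - A) \<inter> flags Q = flags Q - A"
      by (auto simp: flags_J)
    then show ?thesis
      using nb_join[OF A] nb_join[OF J.edge_closed_Diff[OF J.edge_closed_flags A]]
        assms[unfolded const_sum_def, rule_format, OF A] by simp
  qed
  \<comment> \<open>For sets inside \<open>P\<close> the other factor contributes
    \<open>nb Q {}\<close> to one summand and \<open>nb Q (flags Q)\<close> to the other.\<close>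
  have "const_sum P (c + 2 - (nb Q {} + nb Q (flags Q)))"
    unfolding const_sum_def
  proof (intro allI impI)
    fix A assume A: "edge_closed P A"
    then have AP: "A \<subseteq> flags P" by (simp add: edge_closed_def)
    then have e: "A \<inter> flags P = A" "A \<inter> flags Q = {}" "flags Q - A = flags Q" using disj by auto
    then have "edge_closed J A" using A AP by (auto simp: edge_closed_J edge_closed_empty)
    from key[OF this] show "nb P A + nb P (flags P - A) = c + 2 - (nb Q {} + nb Q (flags Q))"
      by (simp add: e)
  qed
  then show "\<exists>d. const_sum P d" by blast
  have "const_sum Q (c + 2 - (nb P {} + nb P (flags P)))"
    unfolding const_sum_def
  proof (intro allI impI)
    fix A assume A: "edge_closed Q A"
    then have AP: "A \<subseteq> flags Q" by (simp add: edge_closed_def)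
    then have e: "A \<inter> flags Q = A" "A \<inter> flags P = {}" "flags P - A = flags P" using disj by auto
    then have "edge_closed J A" using A AP by (auto simp: edge_closed_J edge_closed_empty)
    from key[OF this] show "nb Q A + nb Q (flags Q - A) = c + 2 - (nb P {} + nb P (flags P))"
      by (simp add: e)
  qed
  then show "\<exists>d. const_sum Q d" by blast
qed

end

subsection \<open>Chord diagrams\<close>

text \<open>
  The half-edge at position \<open>i\<close> has the corners \<open>h i False\<close> and \<open>h i True\<close>; its loop has the
  other half-edge at position \<open>\<pi> i\<close>, and \<open>tw i\<close> says that it is twisted.
\<close>

locale chord_diagram = ribbon_graph +
  fixes N :: nat and h :: "nat \<Rightarrow> bool \<Rightarrow> 'a" and \<pi> :: "nat \<Rightarrow> nat" and tw :: "nat \<Rightarrow> bool"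
  assumes N: "0 < N"
    and bij: "bij_betw (\<lambda>(i, b). h i b) ({..<N} \<times> UNIV) X"
    and end_h: "\<And>i b. i < N \<Longrightarrow> e (h i b) = h i (\<not> b)"
    and arc_True: "\<And>i. i < N \<Longrightarrow> a (h i True) = h (Suc i mod N) False"
    and partner_less: "\<And>i. i < N \<Longrightarrow> \<pi> i < N"
    and side_h: "\<And>i b. i < N \<Longrightarrow> s (h i b) = h (\<pi> i) (b = tw i)"
begin

lemma h_in: "i < N \<Longrightarrow> h i b \<in> X"
  using bij by (auto simp: bij_betw_def)

lemma h_eq: "i < N \<Longrightarrow> j < N \<Longrightarrow> h i b = h j c \<longleftrightarrow> i = j \<and> b = c"
  using bij by (auto simp: bij_betw_def inj_on_def)

lemma flag_cases:
  assumes "x \<in> X"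
  obtains i b where "i < N" "x = h i b"
proof -
  have "x \<in> (\<lambda>(i, b). h i b) ` ({..<N} \<times> UNIV)" using assms bij by (simp add: bij_betw_def)
  then show ?thesis using that by auto
qed

text \<open>All of this is forced by the sides being an involution. If \<open>\<pi> i = i\<close>,
  the side of a corner would end at that corner (twisted) or at the other corner of the same ribbon
  end (untwisted).\<close>

lemma partner: "\<pi> (\<pi> i) = i" "tw (\<pi> i) = tw i" "\<pi> i \<noteq> i" if i: "i < N"
proof -
  have "s (s (h i True)) = h i True" using flagD(6)[OF h_in[OF i]] .
  then have "h (\<pi> (\<pi> i)) ((True = tw i) = tw (\<pi> i)) = h i True"
    using side_h i partner_less by simp
  then show "\<pi> (\<pi> i) = i" "tw (\<pi> i) = tw i"
    using h_eq[OF partner_less[OF partner_less[OF i]] i] by auto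
  have "h (\<pi> i) (True = tw i) \<noteq> h i True" "h (\<pi> i) (True = tw i) \<noteq> h i False"
    using flagD(5,12)[OF h_in[OF i, of True]] side_h[OF i, of True] end_h[OF i, of True] by auto
  then show "\<pi> i \<noteq> i" by (cases "tw i") auto
qed

definition pred :: "nat \<Rightarrow> nat" where
  "pred i = (if i = 0 then N - 1 else i - 1)"

lemma pred_less: "i < N \<Longrightarrow> pred i < N"
  using N by (auto simp: pred_def)

lemma pred_Suc: "i < N \<Longrightarrow> pred (Suc i mod N) = i"
  by (cases "Suc i = N") (auto simp: pred_def)

lemma arc_False: "i < N \<Longrightarrow> a (h i False) = h (pred i) True"
proof -
  assume i: "i < N"
  have "Suc (pred i) mod N = i" using i by (auto simp: pred_def)
  then have "a (h (pred i) True) = h i False" using arc_True[OF pred_less[OF i]] by simp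
  then show "a (h i False) = h (pred i) True" using flagD(9)[OF h_in[OF pred_less[OF i], of True]] by simp
qed

definition fl :: "nat set \<Rightarrow> 'a set" where
  "fl P = (\<lambda>(i, b). h i b) ` (P \<times> UNIV)"

definition pclosed :: "nat set \<Rightarrow> bool" where
  "pclosed P \<longleftrightarrow> P \<subseteq> {..<N} \<and> \<pi> ` P \<subseteq> P"

lemma h_in_fl: "P \<subseteq> {..<N} \<Longrightarrow> i < N \<Longrightarrow> h i b \<in> fl P \<longleftrightarrow> i \<in> P"
  unfolding fl_def by (auto simp: h_eq subset_iff)

lemma fl_empty: "fl {} = {}"
  by (simp add: fl_def)

lemma fl_Un: "fl (P \<union> Q) = fl P \<union> fl Q"
  by (auto simp: fl_def)

lemma edge_closed_fl:
  assumes "pclosed P"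
  shows "edge_closed G (fl P)"
  unfolding edge_closed_def
proof (intro conjI ballI)
  show "fl P \<subseteq> X" using assms h_in by (auto simp: fl_def pclosed_def)
  fix x assume "x \<in> fl P"
  then obtain i b where i: "i \<in> P" "x = h i b" by (auto simp: fl_def)
  then have "i < N" "\<pi> i \<in> P" using assms by (auto simp: pclosed_def)
  then show "e x \<in> fl P" "s x \<in> fl P" using i end_h side_h by (auto simp: fl_def)
qed

lemma pclosed_empty: "pclosed {}"
  by (simp add: pclosed_def)

lemma pclosed_chord: "i < N \<Longrightarrow> pclosed {i, \<pi> i}"
  by (auto simp: pclosed_def partner partner_less)

lemma pclosed_Un: "pclosed P \<Longrightarrow> pclosed Q \<Longrightarrow> pclosed (P \<union> Q)"
  by (auto simp: pclosed_def)

lemma edge_at_h: "i < N \<Longrightarrow> edge_at G (h i b) = fl {i, \<pi> i}"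
proof -
  assume i: "i < N"
  have "fl {i, \<pi> i} = {h i True, h i False, h (\<pi> i) True, h (\<pi> i) False}"
    by (auto simp: fl_def UNIV_bool)
  then show ?thesis
    unfolding edge_at_def using end_h[OF i] side_h[OF i] by (cases b; cases "tw i") auto
qed

lemma fl_insert_chord:
  assumes "i < N"
  shows "fl (P \<union> {i, \<pi> i}) = fl P \<union> edge_at G (h i b)"
  using assms by (simp only: fl_Un edge_at_h)

text \<open>A labelling of the arcs, where arc \<open>i\<close> follows position \<open>i\<close>, that is constant along boundary components.\<close>

lemma con_invariant:
  assumes P: "pclosed P"
    and off: "\<And>i. i < N \<Longrightarrow> i \<notin> P \<Longrightarrow> k (pred i) = k i"
    and untw: "\<And>i. i \<in> P \<Longrightarrow> \<not> tw i \<Longrightarrow> k i = k (pred (\<pi> i))"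
    and tw: "\<And>i. i \<in> P \<Longrightarrow> tw i \<Longrightarrow> k i = k (\<pi> i) \<and> k (pred i) = k (pred (\<pi> i))"
    and ij: "i < N" "j < N" "(h i b, h j c) \<in> con (fl P)"
  shows "k (if b then i else pred i) = k (if c then j else pred j)"
proof -
  \<comment> \<open>The corner \<open>h i True\<close> lies on arc \<open>i\<close>, the corner
    \<open>h i False\<close> on the arc before it.\<close>
  let ?K = "\<lambda>i b. k (if b then i else pred i)"
  let ?Z = "{h j c | j c. j < N \<and> ?K j c = ?K i b}"
  have PN: "P \<subseteq> {..<N}" and P\<pi>: "\<And>i. i \<in> P \<Longrightarrow> \<pi> i \<in> P" using P by (auto simp: pclosed_def)
  have "h j c \<in> ?Z"
  proof (rule orel_closed[OF ij(3)])
    show "h i b \<in> ?Z" using ij by blast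
  next
    fix z assume "z \<in> ?Z"
    then obtain j c where j: "j < N" "z = h j c" "?K j c = ?K i b" by blast
    show "sub_edge G (fl P) z \<in> ?Z"
    proof (cases "j \<in> P")
      case False
      then have "?K j (\<not> c) = ?K i b" using off[OF j(1)] j(3) by (cases c) auto
      moreover have "sub_edge G (fl P) z = h j (\<not> c)"
        using False j end_h by (simp add: sub_edge_def h_in_fl[OF PN])
      ultimately show ?thesis using j(1) by blast
    next
      case True
      have K: "?K (\<pi> j) (c = tw j) = ?K i b"
        unfolding j(3)[symmetric]
        using untw[OF True] tw[OF True] untw[OF P\<pi>[OF True]] partner[OF j(1)]
        by (cases c; cases "tw j") auto
      have "sub_edge G (fl P) z = h (\<pi> j) (c = tw j)"
        using True j side_h by (simp add: sub_edge_def h_in_fl[OF PN])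
      then show ?thesis using partner_less[OF j(1)] K by blast
    qed
    show "a z \<in> ?Z"
    proof (cases c)
      case True
      then have "a z = h (Suc j mod N) False" using j arc_True by simp
      moreover have "?K (Suc j mod N) False = ?K i b" using j True by (simp add: pred_Suc)
      moreover have "Suc j mod N < N" using N by simp
      ultimately show ?thesis by blast
    next
      case False
      then have "a z = h (pred j) True" using j arc_False by simp
      moreover have "?K (pred j) True = ?K i b" using j False by simp
      ultimately show ?thesis using pred_less[OF j(1)] by blast
    qed
  qed
  then obtain j' c' where j': "h j c = h j' c'" "j' < N" "?K j' c' = ?K i b" by blast
  then have "j' = j" "c' = c" using h_eq[OF ij(2), of j' c c'] by auto
  then show ?thesis using j'(3)[symmetric] by (simp only:)
qed

text \<open>As long as no half-edge of \<open>P\<close> is met, the boundary curve follows the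
  vertex-disc.\<close>

lemma con_chain:
  assumes P: "pclosed P" and pq: "p \<le> q" "q < N" and off: "\<And>i. p < i \<Longrightarrow> i \<le> q \<Longrightarrow> i \<notin> P"
  shows "(h p True, h q True) \<in> con (fl P)"
  using pq off
proof (induction q rule: dec_induct)
  case base
  then show ?case by (simp add: orel_refl h_in)
next
  case (step q)
  note cl = edge_closed_fl[OF P]
  have PN: "P \<subseteq> {..<N}" using P by (simp add: pclosed_def)
  have q: "Suc q < N" "Suc q \<notin> P" using step by auto
  have "(h q True, h (Suc q) False) \<in> con (fl P)"
    using con_arc[OF cl h_in, of q True] arc_True[of q] q by simp
  moreover have "(h (Suc q) False, h (Suc q) True) \<in> con (fl P)"
    using con_end[OF cl h_in[OF q(1)], of False] end_h[OF q(1)] h_in_fl[OF PN q(1)] q by simp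
  ultimately show ?case using step orel_trans by (meson Suc_leD Suc_lessD le_SucI)
qed

lemma nb_empty: "nb G {} = 1"
proof -
  note cl = edge_closed_fl[OF pclosed_empty, unfolded fl_empty]
  have "con {} `` {x} = X" if x: "x \<in> X" for x
  proof -
    have r: "(h 0 True, y) \<in> con {}" if y: "y \<in> X" for y
    proof -
      obtain i b where i: "i < N" "y = h i b" using y by (rule flag_cases)
      have 1: "(h 0 True, h i True) \<in> con {}"
        using con_chain[OF pclosed_empty, of 0 i] i by (simp add: fl_empty)
      have 2: "(h i True, h i False) \<in> con {}"
        using con_end[OF cl h_in[OF i(1)], of True] end_h[OF i(1)] by simp
      show ?thesis using 1 orel_trans[OF 1 2] i by (cases b) auto
    qed
    show ?thesis using orel_trans[OF con_sym[OF cl r[OF x]] r] orel_dom by fast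
  qed
  then have "X // con {} = {X}" using h_in[OF N] unfolding quotient_def by auto
  then show ?thesis by (simp add: nb_def)
qed

lemma nb_ge_2:
  assumes "edge_closed G A" "x \<in> X" "y \<in> X" "(x, y) \<notin> con A"
  shows "nb G A \<ge> 2"
proof -
  have ne: "x \<noteq> y" using assms orel_refl by metis
  have "card {x, y} \<le> card (X // con A)"
    by (rule finite_quotient_card_ge[OF equiv_con finX])
       (use assms con_sym in auto)
  then show ?thesis using ne by (simp add: nb_def)
qed

section \<open>Interlaced chords, and the values of \<open>nb\<close> for one or two loops\<close>

definition btw :: "nat \<Rightarrow> nat \<Rightarrow> bool" where
  "btw i g \<longleftrightarrow> min i (\<pi> i) < g \<and> g < max i (\<pi> i)"

text \<open>Interlacement: the ends of the two loops alternate around the vertex.\<close>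

definition cross :: "nat \<Rightarrow> nat \<Rightarrow> bool" where
  "cross i j \<longleftrightarrow> j \<noteq> i \<and> j \<noteq> \<pi> i \<and> btw i j \<noteq> btw i (\<pi> j)"

lemma btw_partner: "i < N \<Longrightarrow> btw (\<pi> i) g = btw i g"
  by (auto simp: btw_def partner min.commute max.commute)

lemma cross_partner:
  assumes "i < N" "j < N"
  shows "cross (\<pi> i) j = cross i j" "cross i (\<pi> j) = cross i j"
proof -
  show "cross (\<pi> i) j = cross i j" using assms by (auto simp: cross_def btw_partner partner)
  have "\<pi> j = i \<longleftrightarrow> j = \<pi> i" "\<pi> j = \<pi> i \<longleftrightarrow> j = i" using assms partner(1) by metis+
  then show "cross i (\<pi> j) = cross i j" using assms by (auto simp: cross_def partner)
qed

lemma cross_sym: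
  assumes "i < N" "j < N" "cross i j"
  shows "cross j i"
proof -
  have "\<pi> j = i \<longleftrightarrow> j = \<pi> i" "\<pi> j = \<pi> i \<longleftrightarrow> j = i" using assms partner(1) by metis+
  moreover have "\<pi> i \<noteq> i" "\<pi> j \<noteq> j" using assms partner by auto
  ultimately show ?thesis using assms(3)
    unfolding cross_def btw_def min_def max_def by (auto split: if_splits)
qed

text \<open>The chord of \<open>i\<close> divides the arcs into \<open>p, ..., q - 1\<close> and the
  rest. All other chords of \<open>P\<close> have both ends on one side. The ribbon of
  \<open>i\<close> is untwisted, so one of its sides joins arc \<open>p\<close> to arc
  \<open>q - 1\<close> and the other joins arc \<open>q\<close> to the arc before \<open>p\<close>.
  No boundary curve can change from one part to the other.\<close>

lemma separated_by_untwisted: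
  assumes P: "pclosed P" and i: "i \<in> P" "\<not> tw i" and nc: "\<And>j. j \<in> P \<Longrightarrow> \<not> cross i j"
    and jl: "j < N" "l < N" "(h j b, h l c) \<in> con (fl P)"
  defines "p \<equiv> min i (\<pi> i)" and "q \<equiv> max i (\<pi> i)"
  shows "(p \<le> (if b then j else pred j) \<and> (if b then j else pred j) < q) =
         (p \<le> (if c then l else pred l) \<and> (if c then l else pred l) < q)"
proof -
  have PN: "P \<subseteq> {..<N}" and P\<pi>: "\<And>i. i \<in> P \<Longrightarrow> \<pi> i \<in> P" using P by (auto simp: pclosed_def)
  have iN: "i < N" using i PN by auto
  have pq: "p < q" "q < N" "p \<in> P" "q \<in> P" "\<pi> p = q" "\<pi> q = p" "{p, q} = {i, \<pi> i}"
    using partner[OF iN] partner_less[OF iN] iN i(1) P\<pi> by (auto simp: p_def q_def min_def max_def)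
  show ?thesis
  proof (rule con_invariant[OF P _ _ _ jl, where k = "\<lambda>g. p \<le> g \<and> g < q"])
    fix l assume l: "l < N" "l \<notin> P"
    then have "l \<noteq> p" "l \<noteq> q" using pq by auto
    then show "(p \<le> pred l \<and> pred l < q) = (p \<le> l \<and> l < q)"
      using pq(1,2) by (simp add: pred_def) linarith
  next
    fix l assume l: "l \<in> P"
    have lN: "l < N" using l PN by auto
    have gap: "(p \<le> pred l \<and> pred l < q) = btw i l" "(p \<le> l \<and> l < q) = btw i l"
      if "l \<noteq> p" "l \<noteq> q" for l
      using that pq(1,2) unfolding btw_def p_def[symmetric] q_def[symmetric]
      by (auto simp: pred_def)
    have other: "btw i l = btw i (\<pi> l)" "\<pi> l \<noteq> p" "\<pi> l \<noteq> q" if "l \<noteq> p" "l \<noteq> q"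
    proof -
      have "l \<noteq> i" "l \<noteq> \<pi> i" using that pq(7) by auto
      then show "btw i l = btw i (\<pi> l)" using nc[OF l] by (auto simp: cross_def)
      show "\<pi> l \<noteq> p" "\<pi> l \<noteq> q" using that pq(5,6) partner(1)[OF lN] by metis+
    qed
    { assume ntw: "\<not> tw l"
      show "(p \<le> l \<and> l < q) = (p \<le> pred (\<pi> l) \<and> pred (\<pi> l) < q)"
      proof (cases "l = p \<or> l = q")
        case True
        then show ?thesis using pq by (auto simp: pred_def)
      next
        case False
        then show ?thesis using gap[of l] gap[of "\<pi> l"] other by simp
      qed
    }
    { assume "tw l"
      then have "l \<noteq> p \<and> l \<noteq> q" using i(2) partner(2)[OF iN] pq(7)
        by (metis doubleton_eq_iff)
      then show "(p \<le> l \<and> l < q) = (p \<le> \<pi> l \<and> \<pi> l < q) \<and>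
          (p \<le> pred l \<and> pred l < q) = (p \<le> pred (\<pi> l) \<and> pred (\<pi> l) < q)"
        using gap[of l] gap[of "\<pi> l"] other by simp
    }
  qed
qed

lemma untwisted_not_con:
  assumes P: "pclosed P" and i: "i \<in> P" "\<not> tw i" and nc: "\<And>j. j \<in> P \<Longrightarrow> \<not> cross i j"
  shows "(h i b, e (h i b)) \<notin> con (fl P)"
proof
  have iN: "i < N" using i P by (auto simp: pclosed_def)
  assume "(h i b, e (h i b)) \<in> con (fl P)"
  then have "(h i b, h i (\<not> b)) \<in> con (fl P)" using end_h[OF iN] by simp
  from separated_by_untwisted[OF P i nc iN iN this]
  show False using partner(3)[OF iN] partner_less[OF iN] iN
    by (cases b) (auto simp: pred_def min_def max_def split: if_splits)
qed

text \<open>The two corners of an end of \<open>i\<close> lie on different sides of its chord, hence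
  on different components; deleting the ribbon merges these.\<close>

lemma nb_add_untwisted:
  assumes P: "pclosed P" and i: "i < N" "i \<notin> P" "\<not> tw i" and nc: "\<And>j. j \<in> P \<Longrightarrow> \<not> cross i j"
  shows "nb G (fl (P \<union> {i, \<pi> i})) = nb G (fl P) + 1"
proof -
  have PN: "P \<subseteq> {..<N}" using P by (simp add: pclosed_def)
  have "\<not> cross i j" if "j \<in> P \<union> {i, \<pi> i}" for j
    using nc that by (auto simp: cross_def)
  then have "(h i True, e (h i True)) \<notin> con (fl (P \<union> {i, \<pi> i}))"
    by (intro untwisted_not_con pclosed_Un P pclosed_chord) (use i in auto)
  then show ?thesis
    using remove_edge_apart(1)[OF edge_closed_fl[OF P] h_in[OF i(1)], of True] i(2) h_in_fl[OF PN i(1)]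
    unfolding fl_insert_chord[OF i(1), of P True] by simp
qed

lemma nb_untwisted: "i < N \<Longrightarrow> \<not> tw i \<Longrightarrow> nb G (fl {i, \<pi> i}) = 2"
  using nb_add_untwisted[OF pclosed_empty, of i] nb_empty by (simp add: fl_empty)

lemma nb_untwisted_pair:
  assumes "i < N" "j < N" "\<not> tw i" "\<not> tw j" "j \<noteq> i" "j \<noteq> \<pi> i" "\<not> cross i j"
  shows "nb G (fl ({i, \<pi> i} \<union> {j, \<pi> j})) = 3"
proof -
  have "\<not> cross j i" "\<not> cross j (\<pi> i)"
    using assms cross_sym cross_partner by metis+
  then show ?thesis
    using nb_add_untwisted[OF pclosed_chord[OF assms(1)], of j] nb_untwisted[OF assms(1,3)] assms by auto
qed

text \<open>The ribbon of \<open>i\<close> alone has one boundary component on each side of its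
  chord. The ends of \<open>j\<close> lie on different sides, so its ribbon, twisted or not, joins
  the two components.\<close>

lemma nb_cross_untwisted:
  assumes ij: "i < N" "j < N" "\<not> tw i" "cross i j"
  shows "nb G (fl ({i, \<pi> i} \<union> {j, \<pi> j})) = 1"
proof -
  note P = pclosed_chord[OF ij(1)]
  have PN: "{i, \<pi> i} \<subseteq> {..<N}" using ij partner_less by auto
  have j: "j \<notin> {i, \<pi> i}" using ij(4) by (auto simp: cross_def)
  have j': "\<pi> j \<notin> {i, \<pi> i}" using j ij(1,2) partner(1) by (metis insert_iff singletonD)
  have "(h j True, s (h j True)) \<notin> con (fl {i, \<pi> i})"
  proof
    assume "(h j True, s (h j True)) \<in> con (fl {i, \<pi> i})"
    then have r: "(h j True, h (\<pi> j) (True = tw j)) \<in> con (fl {i, \<pi> i})"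
      using side_h[OF ij(2)] by simp
    have nc: "\<not> cross i l" if "l \<in> {i, \<pi> i}" for l using that by (auto simp: cross_def)
    have "btw i j = btw i (\<pi> j)"
      using separated_by_untwisted[OF P _ ij(3) nc ij(2) partner_less[OF ij(2)] r]
        j j' partner_less[OF ij(1)] ij(1)
      by (auto simp: btw_def pred_def min_def max_def split: if_splits)
    then show False using ij(4) by (simp add: cross_def)
  qed
  then have "nb G (fl {i, \<pi> i}) = nb G (fl {i, \<pi> i} \<union> edge_at G (h j True)) + 1"
    by (intro add_edge_apart edge_closed_fl P h_in ij) (use j h_in_fl[OF PN ij(2)] in auto)
  then show ?thesis
    using nb_untwisted[OF ij(1,3)] fl_insert_chord[OF ij(2), of "{i, \<pi> i}" True] by simp
qed

text \<open>From \<open>h p True\<close> the curve follows the twisted ribbon to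
  \<open>h q True\<close> and then the vertex-disc round to \<open>h p False\<close>. Both corners
  of an end thus stay on one curve, so adding the ribbon to the bare vertex splits nothing.\<close>

lemma nb_twisted:
  assumes i0: "i < N" "tw i"
  shows "nb G (fl {i, \<pi> i}) = 1"
proof -
  define p where "p = min i (\<pi> i)"
  define q where "q = max i (\<pi> i)"
  have pq: "p < q" "q < N" "\<pi> p = q" "tw p" "{p, q} = {i, \<pi> i}"
    using partner[OF i0(1)] partner_less[OF i0(1)] i0 by (auto simp: p_def q_def min_def max_def)
  have pN: "p < N" using pq by simp
  note P = pclosed_chord[OF pN, unfolded pq(3)]
  note cl = edge_closed_fl[OF P]
  have PN: "{p, q} \<subseteq> {..<N}" using pq(1,2) by auto
  have 1: "(h p True, h q True) \<in> con (fl {p, q})"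
    using con_side[OF cl, of "h p True"] side_h[OF pN, of True] pq(3,4) h_in_fl[OF PN pN, of True] by simp
  have 2: "(h q True, h (N - 1) True) \<in> con (fl {p, q})"
    by (rule con_chain[OF P]) (use pq(1,2) in auto)
  have 3: "(h (pred p) True, h p False) \<in> con (fl {p, q})"
    using con_sym[OF cl con_arc[OF cl h_in[OF pN, of False]]] arc_False[OF pN] by simp
  \<comment> \<open>The passage across the end of the word, which \<open>con_chain\<close> does not
    cover. For \<open>p = 0\<close> the arc before \<open>p\<close> is already arc
    \<open>N - 1\<close>.\<close>
  have 4: "(h (N - 1) True, h (pred p) True) \<in> con (fl {p, q})"
  proof (cases "p = 0")
    case True
    then show ?thesis using N by (simp add: pred_def orel_refl h_in)
  next
    case False
    have "(h (N - 1) True, h 0 False) \<in> con (fl {p, q})"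
      using con_arc[OF cl h_in, of "N - 1" True] arc_True[of "N - 1"] N by simp
    moreover have "(h 0 False, h 0 True) \<in> con (fl {p, q})"
      using con_end[OF cl h_in[OF N], of False] end_h[OF N] h_in_fl[OF PN N] False pq(1) by simp
    moreover have "(h 0 True, h (pred p) True) \<in> con (fl {p, q})"
      by (rule con_chain[OF P]) (use pq(1,2) False in \<open>auto simp: pred_def\<close>)
    ultimately show ?thesis using orel_trans by metis
  qed
  have "(h p True, e (h p True)) \<in> con (fl {p, q})"
    using orel_trans[OF orel_trans[OF orel_trans[OF 1 2] 4] 3] end_h[OF pN] by simp
  moreover have ed: "{} \<union> edge_at G (h p True) = fl {p, q}" using edge_at_h[OF pN] pq(3) by simp
  moreover have "(h p True, s (h p True)) \<in> con {}"
    using nb_ge_2[OF edge_closed_empty h_in[OF pN] flagD(4)[OF h_in[OF pN]]] nb_empty by fastforce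
  ultimately have "con (fl {p, q}) = con {}"
    using add_edge_together(3)[OF edge_closed_empty h_in[OF pN], of True] by simp
  then show ?thesis using nb_empty pq(5) by (simp add: nb_def)
qed

lemma nb_cross_twisted:
  assumes ij: "i < N" "j < N" "tw i" "tw j" "cross i j"
  shows "nb G (fl ({i, \<pi> i} \<union> {j, \<pi> j})) \<ge> 2"
proof -
  have key: "nb G (fl ({i, \<pi> i} \<union> {j, \<pi> j})) \<ge> 2"
    if ij: "i < N" "j < N" "tw i" "tw j" and lt: "i < j" "j < \<pi> i" "\<pi> i < \<pi> j" for i j
  proof -
    let ?P = "{i, \<pi> i} \<union> {j, \<pi> j}"
    \<comment> \<open>The four ends cut the arcs into four groups; \<open>?k\<close> selects two
      opposite ones. A twisted ribbon joins the arcs after its two ends, and likewise the arcs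
      before them, and so only connects opposite groups.\<close>
    let ?k = "\<lambda>g. i \<le> g \<and> g < j \<or> \<pi> i \<le> g \<and> g < \<pi> j"
    have P: "pclosed ?P" by (intro pclosed_Un pclosed_chord ij)
    note pt = partner[OF ij(1)] partner[OF ij(2)] partner_less[OF ij(1)] partner_less[OF ij(2)]
    have "(h i True, h i False) \<notin> con (fl ?P)"
    proof
      assume "(h i True, h i False) \<in> con (fl ?P)"
      then have "?k (if True then i else pred i) = ?k (if False then i else pred i)"
      proof (rule con_invariant[OF P _ _ _ ij(1) ij(1), where k = ?k, rotated -1])
        fix l assume "l < N" "l \<notin> ?P"
        then show "?k (pred l) = ?k l" using lt pt by (auto simp: pred_def)
      next
        fix l assume "l \<in> ?P" "\<not> tw l"
        then show "?k l = ?k (pred (\<pi> l))" using ij pt by auto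
      next
        fix l assume "l \<in> ?P"
        then show "?k l = ?k (\<pi> l) \<and> ?k (pred l) = ?k (pred (\<pi> l))"
          using lt pt ij by (auto simp: pred_def)
      qed
      then show False using lt pt ij by (auto simp: pred_def split: if_splits)
    qed
    then show ?thesis by (rule nb_ge_2[OF edge_closed_fl[OF P] h_in[OF ij(1)] h_in[OF ij(1)]])
  qed
  define p where "p = min i (\<pi> i)"
  define q where "q = min j (\<pi> j)"
  note pt = partner[OF ij(1)] partner[OF ij(2)]
  have p: "p < N" "tw p" "{p, \<pi> p} = {i, \<pi> i}" "p < \<pi> p"
    using pt partner_less[OF ij(1)] ij by (auto simp: p_def min_def)
  have q: "q < N" "tw q" "{q, \<pi> q} = {j, \<pi> j}" "q < \<pi> q"
    using pt partner_less[OF ij(2)] ij by (auto simp: q_def min_def)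
  have cr: "cross p q"
    using ij(5) cross_partner[OF ij(1,2)] cross_partner[OF ij(1) partner_less[OF ij(2)]] by (auto simp: p_def q_def min_def)
  have ne: "q \<noteq> p" "q \<noteq> \<pi> p" "\<pi> q \<noteq> p" "\<pi> q \<noteq> \<pi> p"
    using cr partner(1)[OF p(1)] partner(1)[OF q(1)] by (auto simp: cross_def)
  \<comment> \<open>With \<open>p\<close> and \<open>q\<close> the first ends of their chords,
    interlacement leaves two orders, which differ by exchanging the chords.\<close>
  then consider "p < q" "q < \<pi> p" "\<pi> p < \<pi> q" | "q < p" "p < \<pi> q" "\<pi> q < \<pi> p"
  proof -
    have "btw p g \<longleftrightarrow> p < g \<and> g < \<pi> p" for g using p(4) by (simp add: btw_def)
    then have "(p < q \<and> q < \<pi> p) \<noteq> (p < \<pi> q \<and> \<pi> q < \<pi> p)" using cr by (simp add: cross_def)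
    then show thesis using ne q(4) p(4) that by linarith
  qed
  then show ?thesis
  proof cases
    case 1
    show ?thesis using key[OF p(1) q(1) p(2) q(2) 1] p(3) q(3) by simp
  next
    case 2
    show ?thesis using key[OF q(1) p(1) q(2) p(2) 2] p(3) q(3) by (simp add: Un_commute insert_commute)
  qed
qed

end

subsection \<open>Crossing chords when the sum is constant\<close>

locale const_chord_diagram = chord_diagram +
  fixes c :: nat
  assumes cst: "const_sum G c"
begin

lemma c_eq: "c = nb G X + 1"
  using cst nb_empty edge_closed_empty unfolding const_sum_def by fastforce

text \<open>Constancy compared with the empty set: a count for the loops in \<open>P\<close> alone
  becomes a count for the bouquet without them.\<close>

lemma nb_Diff: "pclosed P \<Longrightarrow> nb G (fl P) + nb G (X - fl P) = nb G X + 1"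
  using cst c_eq edge_closed_fl unfolding const_sum_def by simp

lemma pclosed_sub: "pclosed P \<Longrightarrow> P \<subseteq> {..<N}"
  by (simp add: pclosed_def)

abbreviation "ends i \<equiv> {h i False, h i True}"

lemma remove_chord:
  assumes P: "pclosed P" and i: "i < N" "i \<notin> P"
  defines "R \<equiv> X - fl (P \<union> {i, \<pi> i})" and "S \<equiv> X - fl P"
  shows "(h i False, h i True) \<notin> con S \<Longrightarrow> nb G S = nb G R + 1"
    and "(h i False, h i True) \<notin> con S \<Longrightarrow> con R = con S \<union> (con S `` ends i) \<times> (con S `` ends i)"
    and "(h i False, h i True) \<in> con S \<Longrightarrow> nb G S \<le> nb G R"
    and "(h i False, h i True) \<in> con S \<Longrightarrow> nb G S = nb G R \<Longrightarrow> con R = con S"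
proof -
  let ?x = "h i False"
  have R: "edge_closed G R"
    unfolding R_def by (intro edge_closed_Diff edge_closed_flags edge_closed_fl pclosed_Un pclosed_chord assms)
  have x: "?x \<in> X" by (rule h_in[OF i(1)])
  have E: "fl (P \<union> {i, \<pi> i}) = fl P \<union> edge_at G ?x" by (rule fl_insert_chord[OF i(1)])
  have xR: "?x \<notin> R" unfolding R_def E using edge_at_self by auto
  have "?x \<notin> fl P" using i(2) by (simp add: h_in_fl[OF pclosed_sub[OF P] i(1)])
  then have "edge_at G ?x \<inter> fl P = {}" by (rule edge_at_disjoint[OF edge_closed_fl[OF P] x])
  moreover have "edge_at G ?x \<subseteq> X" by (rule edge_at_subset[OF edge_closed_flags x])
  ultimately have S: "R \<union> edge_at G ?x = S" unfolding R_def S_def E by blast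
  have ex: "e ?x = h i True" using end_h[OF i(1)] by simp
  note ra = remove_edge_apart[OF R x xR, unfolded S ex]
    and rt = remove_edge_together[OF R x xR, unfolded S ex]
  show "(h i False, h i True) \<notin> con S \<Longrightarrow> nb G S = nb G R + 1"
    "(h i False, h i True) \<notin> con S \<Longrightarrow> con R = con S \<union> (con S `` ends i) \<times> (con S `` ends i)"
    "(h i False, h i True) \<in> con S \<Longrightarrow> nb G S \<le> nb G R"
    "(h i False, h i True) \<in> con S \<Longrightarrow> nb G S = nb G R \<Longrightarrow> con R = con S"
    using ra rt by simp_all
qed

lemmas remove_first = remove_chord[OF pclosed_empty _ equals0D[OF refl], unfolded fl_empty Diff_empty Un_empty_left]

text \<open>A single untwisted loop has two boundary components, so its deletion from the whole
  bouquet must lose one; only a merge of the components at the two corners of an end can do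
  that.\<close>

lemma untwisted_apart:
  assumes i: "i < N" "\<not> tw i"
  shows "(h i False, h i True) \<notin> con X"
proof
  assume "(h i False, h i True) \<in> con X"
  then have "nb G X \<le> nb G (X - fl {i, \<pi> i})" using remove_first(3)[OF i(1)] by simp
  then show False using nb_Diff[OF pclosed_chord[OF i(1)]] nb_untwisted[OF i] by simp
qed

lemma remove_untwisted:
  assumes i: "i < N" "\<not> tw i"
  shows "nb G X = nb G (X - fl {i, \<pi> i}) + 1"
    and "con (X - fl {i, \<pi> i}) = con X \<union> (con X `` ends i) \<times> (con X `` ends i)"
  using remove_first(1,2)[OF i(1) untwisted_apart[OF i]] by simp_all

text \<open>A single twisted loop has one boundary component, so its deletion must preserve the
  count. This excludes a merge, and then equal counts leave the components themselves
  unchanged.\<close>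

lemma remove_twisted:
  assumes i: "i < N" "tw i"
  shows "nb G X = nb G (X - fl {i, \<pi> i})"
    and "con (X - fl {i, \<pi> i}) = con X"
    and "(h i False, h i True) \<in> con X"
proof -
  show nb: "nb G X = nb G (X - fl {i, \<pi> i})"
    using nb_Diff[OF pclosed_chord[OF i(1)]] nb_twisted[OF i] by simp
  show r: "(h i False, h i True) \<in> con X"
    using remove_first(1)[OF i(1)] nb by fastforce
  show "con (X - fl {i, \<pi> i}) = con X"
    using remove_first(4)[OF i(1) r nb] .
qed

lemma remove_second:
  assumes ij: "i < N" "j < N" "j \<noteq> i" "j \<noteq> \<pi> i"
  defines "R \<equiv> X - fl ({i, \<pi> i} \<union> {j, \<pi> j})"
  shows "(h j False, h j True) \<notin> con (X - fl {i, \<pi> i}) \<Longrightarrow> nb G (X - fl {i, \<pi> i}) = nb G R + 1"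
    and "(h j False, h j True) \<in> con (X - fl {i, \<pi> i}) \<Longrightarrow> nb G (X - fl {i, \<pi> i}) \<le> nb G R"
    and "nb G (fl ({i, \<pi> i} \<union> {j, \<pi> j})) + nb G R = nb G X + 1"
proof -
  have n: "j \<notin> {i, \<pi> i}" using ij by auto
  note rc = remove_chord[OF pclosed_chord[OF ij(1)] ij(2) n, folded R_def]
  show "(h j False, h j True) \<notin> con (X - fl {i, \<pi> i}) \<Longrightarrow> nb G (X - fl {i, \<pi> i}) = nb G R + 1"
    "(h j False, h j True) \<in> con (X - fl {i, \<pi> i}) \<Longrightarrow> nb G (X - fl {i, \<pi> i}) \<le> nb G R"
    using rc(1,3) by simp_all
  show "nb G (fl ({i, \<pi> i} \<union> {j, \<pi> j})) + nb G R = nb G X + 1"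
    unfolding R_def by (intro nb_Diff pclosed_Un pclosed_chord ij)
qed

lemma Image_pair: "r `` {u, v} = r `` {u} \<union> r `` {v}"
  by blast

lemma twisted_no_cross:
  assumes ij: "i < N" "j < N" "tw i"
  shows "\<not> cross i j"
proof
  assume cr: "cross i j"
  then have d: "j \<noteq> i" "j \<noteq> \<pi> i" "\<pi> j \<noteq> i" "i \<noteq> j" "i \<noteq> \<pi> j"
    using ij partner(1) by (auto simp: cross_def)
  show False
  proof (cases "tw j")
    case True
    \<comment> \<open>Deleting \<open>i\<close> changes no component, so deleting \<open>j\<close>
      afterwards loses none either; but two crossing twisted loops have at least two boundary
      components and demand a loss.\<close>
    have "(h j False, h j True) \<in> con (X - fl {i, \<pi> i})"
      using remove_twisted[OF ij(1,3)] remove_twisted(3)[OF ij(2) True] by simp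
    then show False
      using remove_second(2,3)[OF ij(1,2) d(1,2)] remove_twisted(1)[OF ij(1,3)]
        nb_cross_twisted[OF ij(1,2,3) True cr] by simp
  next
    case False
    \<comment> \<open>Here deleting \<open>j\<close> after \<open>i\<close> loses a component,
      whereas the single boundary component of the pair demands that none is lost in total.\<close>
    have "(h j False, h j True) \<notin> con (X - fl {i, \<pi> i})"
      using remove_twisted[OF ij(1,3)] untwisted_apart[OF ij(2) False] by simp
    moreover have "nb G (fl ({i, \<pi> i} \<union> {j, \<pi> j})) = 1"
      using nb_cross_untwisted[OF ij(2,1) False cross_sym[OF ij(1,2) cr]] by (simp add: Un_commute insert_commute)
    ultimately show False
      using remove_second(1,3)[OF ij(1,2) d(1,2)] remove_twisted(1)[OF ij(1,3)] by simp
  qed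
qed

text \<open>Deleting \<open>i\<close> loses one component by merging the two at its ends. In total
  the pair must lose none if it crosses and two if it does not. So the deletion of \<open>j\<close>
  must lose one exactly in the second case, which means that the corners of \<open>j\<close> are not
  both in the merged component.\<close>

lemma cross_iff_same_classes:
  assumes ij: "i < N" "j < N" "\<not> tw i" "\<not> tw j" and d: "j \<noteq> i" "j \<noteq> \<pi> i"
  shows "cross i j \<longleftrightarrow> con X `` ends i = con X `` ends j"
proof
  note rs = remove_second[OF ij(1,2) d] and ru = remove_untwisted[OF ij(1,3)]
  note tr = orel_trans and sy = con_sym[OF edge_closed_flags]
  {
    assume "cross i j"
    then have "nb G (fl ({i, \<pi> i} \<union> {j, \<pi> j})) = 1" by (rule nb_cross_untwisted[OF ij(1-3)])
    then have "(h j False, h j True) \<in> con (X - fl {i, \<pi> i})" using rs ru(1) by linarith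
    then have "h j False \<in> con X `` ends i" "h j True \<in> con X `` ends i"
      using ru(2) untwisted_apart[OF ij(2,4)] by auto
    then obtain p q where pq: "p \<in> ends i" "q \<in> ends i" "(p, h j False) \<in> con X" "(q, h j True) \<in> con X"
      by (meson Image_iff)
    \<comment> \<open>The corners of \<open>j\<close> lie in different components before the
      deletion, so they occupy both of the merged ones.\<close>
    have "p \<noteq> q" using pq(3,4) untwisted_apart[OF ij(2,4)] tr sy by metis
    then have "ends i = {p, q}" using pq by auto
    moreover have "con X `` {p} = con X `` {h j False}" "con X `` {q} = con X `` {h j True}"
      using pq equiv_class_eq[OF equiv_con[OF edge_closed_flags]] by auto
    ultimately show "con X `` ends i = con X `` ends j"
      using Image_pair by metis
  next
    assume eq: "con X `` ends i = con X `` ends j"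
    show "cross i j"
    proof (rule ccontr)
      assume "\<not> cross i j"
      then have 3: "nb G (fl ({i, \<pi> i} \<union> {j, \<pi> j})) = 3" using nb_untwisted_pair ij d by blast
      have "h j b \<in> con X `` ends i" for b
        unfolding eq using orel_refl[OF h_in[OF ij(2)]] by (cases b) auto
      then have "(h j False, h j True) \<in> con (X - fl {i, \<pi> i})" using ru(2) by blast
      then show False using rs(2,3) ru(1) 3 by linarith
    qed
  }
qed

section \<open>Crossing as an equivalence relation\<close>

lemma classes_partner:
  assumes i: "i < N" "\<not> tw i"
  shows "con X `` ends (\<pi> i) = con X `` ends i"
proof -
  have "(h i b, h (\<pi> i) (\<not> b)) \<in> con X" for b
    using con_side[OF edge_closed_flags h_in[OF i(1), of b]] side_h[OF i(1)] i(2) by simp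
  then have "con X `` {h i b} = con X `` {h (\<pi> i) (\<not> b)}" for b
    using equiv_class_eq[OF equiv_con[OF edge_closed_flags]] by blast
  from this[of True] this[of False] show ?thesis by (simp add: Image_pair Un_commute)
qed

definition linked :: "nat \<Rightarrow> nat \<Rightarrow> bool" where
  "linked i j \<longleftrightarrow> j = i \<or> j = \<pi> i \<or> cross i j"

text \<open>This is where transitivity comes from: for untwisted loops the relation is equality of
  an invariant, and a twisted loop is related to its own two ends only.\<close>

lemma linked_iff:
  assumes "i < N" "j < N"
  shows "linked i j \<longleftrightarrow> (if tw i \<or> tw j then j = i \<or> j = \<pi> i else con X `` ends i = con X `` ends j)"
proof (cases "tw i \<or> tw j")
  case True
  then have "\<not> cross i j"
    using twisted_no_cross assms cross_sym by metis
  then show ?thesis using True by (simp add: linked_def)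
next
  case False
  then show ?thesis
    using cross_iff_same_classes[OF assms] classes_partner[OF assms(1)]
    by (cases "j = i \<or> j = \<pi> i") (auto simp: linked_def)
qed

lemma linked_trans:
  assumes "i < N" "j < N" "k < N" "linked i j" "linked j k"
  shows "linked i k"
proof -
  consider "j = i" | "j = \<pi> i" | "\<not> tw i" "\<not> tw j"
    using assms linked_iff by metis
  then show ?thesis
  proof cases
    case 2
    then show ?thesis
      using assms partner(1)[OF assms(1)] cross_partner[OF assms(1,3)] by (auto simp: linked_def)
  next
    case 3
    then show ?thesis
      using assms linked_iff[OF assms(1,2)] linked_iff[OF assms(2,3)] linked_iff[OF assms(1,3)]
        partner(2)[OF assms(2)] by auto
  qed (use assms in auto)
qed

lemma linked_sym: "i < N \<Longrightarrow> j < N \<Longrightarrow> linked i j \<Longrightarrow> linked j i"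
  using cross_sym partner(1) by (metis linked_def)

text \<open>The interval is the first gap of the class of position 0. A chord that left it at
  \<open>r\<close> would end behind the later class member \<open>q\<close> and so separate
  \<open>q\<close> from 0. No chord of the class crosses it, hence the chords of 0 and
  \<open>q\<close> lie on different sides of it. But these are linked and distinct, so they would
  have to cross.\<close>

lemma exists_closed_interval:
  assumes "j < N" "\<not> linked 0 j"
  shows "\<exists>u q. 0 < u \<and> u < q \<and> q \<le> N \<and> \<pi> ` {u..<q} \<subseteq> {u..<q}"
proof -
  define u where "u = (LEAST u. \<not> linked 0 u)"
  have u: "\<not> linked 0 u" "u \<le> j" and below: "\<And>l. l < u \<Longrightarrow> linked 0 l"
    using LeastI[of "\<lambda>u. \<not> linked 0 u", OF assms(2)] Least_le[of "\<lambda>u. \<not> linked 0 u", OF assms(2)]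
      not_less_Least[of _ "\<lambda>u. \<not> linked 0 u"] unfolding u_def[symmetric] by blast+
  \<comment> \<open>The value \<open>N\<close> covers a gap that extends to the end of the
    word.\<close>
  define q where "q = (LEAST q. u < q \<and> (q = N \<or> linked 0 q))"
  have "u < N \<and> (N = N \<or> linked 0 N)" using u assms(1) by simp
  then have q: "u < q" "q = N \<or> linked 0 q" and qN: "q \<le> N"
    using LeastI[of "\<lambda>q. u < q \<and> (q = N \<or> linked 0 q)" N] Least_le[of "\<lambda>q. u < q \<and> (q = N \<or> linked 0 q)" N]
    unfolding q_def[symmetric] by blast+
  have between: "\<not> linked 0 l" if "u \<le> l" "l < q" for l
    using not_less_Least[of l "\<lambda>q. u < q \<and> (q = N \<or> linked 0 q)"] that u(1)
    unfolding q_def by (cases "l = u") auto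
  have u0: "0 < u" using u(1) by (metis gr0I linked_def)
  have "\<pi> r \<in> {u..<q}" if r: "r \<in> {u..<q}" for r
  proof (rule ccontr)
    assume out: "\<pi> r \<notin> {u..<q}"
    have rN: "r < N" using r qN by auto
    have nr: "\<not> linked 0 r" using between r by auto
    have nv: "\<not> linked 0 (\<pi> r)"
      using nr cross_partner(2)[OF N rN] partner(1)[OF rN] partner(1)[OF N] by (metis linked_def)
    have uv: "u \<le> \<pi> r" using below nv by (meson not_le)
    have "\<pi> r \<noteq> q" using nv q partner_less[OF rN] by auto
    then have v: "q < \<pi> r" using out uv by auto
    then have qN': "q < N" and lq: "linked 0 q" using partner_less[OF rN] q by auto
    \<comment> \<open>By transitivity a chord crossing a member of the class would belong to the
      class.\<close>
    have far: "\<not> cross r l" if "l < N" "linked 0 l" for l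
      using nr that linked_trans[OF N that(1) rN] cross_sym[OF rN that(1)] by (auto simp: linked_def)
    have q\<pi>: "linked 0 (\<pi> q)"
      using lq linked_trans[OF N qN' partner_less[OF qN']] by (auto simp: linked_def)
    have lt: "r < \<pi> r" using r v by simp
    have ne: "q \<noteq> r" "q \<noteq> \<pi> r" "0 \<noteq> r" "0 \<noteq> \<pi> r" using r v u0 by auto
    have 1: "btw r q" "\<not> btw r 0" using r v u0 by (auto simp: btw_def)
    have 2: "btw r (\<pi> q)" using far[OF qN' lq] 1 ne by (auto simp: cross_def)
    have "linked 0 0" by (simp add: linked_def)
    then have 3: "\<not> btw r (\<pi> 0)" using far[OF N] 1 ne by (auto simp: cross_def)
    have "\<pi> 0 \<noteq> q" using 1 3 by auto
    then have "cross 0 q" using lq ne u0 q by (auto simp: linked_def)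
    moreover have "btw 0 q \<longleftrightarrow> q < \<pi> 0" "btw 0 (\<pi> q) \<longleftrightarrow> \<pi> q < \<pi> 0"
      using q(1) 2 lt by (auto simp: btw_def)
    moreover have "q < \<pi> 0 \<longleftrightarrow> \<pi> q < \<pi> 0" using 1 2 3 lt by (auto simp: btw_def)
    ultimately show False by (simp add: cross_def)
  qed
  then show ?thesis using u0 q qN by blast
qed

end

subsection \<open>Enumerating the corners of a bouquet\<close>

context ribbon_graph
begin

text \<open>Positions are numbered by walking around the vertex from \<open>x0\<close>, crossing a
  ribbon end and then an arc in each step; \<open>N\<close> is the first return time.\<close>

lemma bouquet_chord_diagram:
  assumes nb1: "nb G {} = 1" and x0: "x0 \<in> X"
  shows "\<exists>N h \<pi> tw. chord_diagram G N h \<pi> tw"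
proof -
  define \<rho> where "\<rho> x = a (e x)" for x
  define r where "r i = (\<rho> ^^ i) x0" for i
  have r0: "r 0 = x0" and rS: "r (Suc i) = a (e (r i))" for i by (simp_all add: r_def \<rho>_def)
  have rX: "r i \<in> X" for i by (induction i) (use x0 flagD in \<open>auto simp: r0 rS\<close>)
  have eX: "e (r i) \<in> X" for i using flagD(1)[OF rX] .
  have ar: "a (r (Suc i)) = e (r i)" for i using flagD(9)[OF eX] by (simp add: rS)
  \<comment> \<open>Each step is reversible, so a repetition anywhere gives a return to the
    start.\<close>
  have down: "r (i + d) = r i \<Longrightarrow> r d = x0" for i d
  proof (induction i)
    case (Suc i)
    then have "a (r (Suc (i + d))) = a (r (Suc i))" by simp
    then have "e (e (r (i + d))) = e (e (r i))" by (simp only: ar)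
    then have "r (i + d) = r i" using flagD(3)[OF rX] by simp
    then show ?case by (rule Suc.IH)
  qed (simp add: r0)
  have "\<not> inj r" using finite_subset[OF _ finX, of "range r"] rX finite_imageD[of r UNIV] by auto
  then obtain i j where "r i = r j" "i < j" by (metis injI linorder_neqE_nat)
  then have "0 < j - i \<and> r (j - i) = x0" using down[of i "j - i"] by simp
  then have ex: "\<exists>n. 0 < n \<and> r n = x0" by blast
  define N where "N = (LEAST n. 0 < n \<and> r n = x0)"
  have N: "0 < N" "r N = x0" using LeastI_ex[OF ex] by (simp_all add: N_def)
  have min: "r n \<noteq> x0" if "0 < n" "n < N" for n
    using not_less_Least[of n "\<lambda>n. 0 < n \<and> r n = x0"] that by (auto simp: N_def)
  have inj: "r i \<noteq> r j" if "i < j" "j < N" for i j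
    using down[of i "j - i"] min[of "j - i"] that by auto
  \<comment> \<open>The walk never meets a ribbon end from its other corner. Otherwise the two
    visits could be moved towards each other, shortening \<open>d\<close> by two, until a ribbon end
    or an arc would have equal endpoints.\<close>
  have flip_le: "r (j + d) \<noteq> e (r j)" for d j
  proof (induction d arbitrary: j rule: less_induct)
    case (less d)
    consider "d = 0" | "d = 1" | d' where "d = Suc (Suc d')" by (metis One_nat_def not0_implies_Suc)
    then show ?case
    proof cases
      case 1
      then show ?thesis using flagD(2)[OF rX, of j] by auto
    next
      case 2
      then show ?thesis using flagD(8)[OF eX, of j] by (auto simp: rS)
    next
      case 3
      show ?thesis
      proof
        assume "r (j + d) = e (r j)"
        then have "a (e (r (Suc j + d'))) = e (r j)" using 3 by (simp add: rS)
        then have "e (r (Suc j + d')) = a (e (r j))" using flagD(9)[OF eX] by metis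
        then have "e (e (r (Suc j + d'))) = e (r (Suc j))" by (simp add: rS)
        then have "r (Suc j + d') = e (r (Suc j))" using flagD(3)[OF rX] by simp
        then show False using less.IH[of d' "Suc j"] 3 by simp
      qed
    qed
  qed
  have flip: "r i \<noteq> e (r j)" for i j
  proof (cases "j \<le> i")
    case True
    then show ?thesis using flip_le[of j "i - j"] by simp
  next
    case False
    then have "r j \<noteq> e (r i)" using flip_le[of i "j - i"] by simp
    then show ?thesis using flagD(3)[OF rX] by metis
  qed
  define h where "h i b = (if b then e (r i) else r i)" for i b
  have hX: "h i b \<in> X" for i b using rX eX by (simp add: h_def)
  have h_inj: "i = j \<and> b = c" if "i < N" "j < N" "h i b = h j c" for i j b c
  proof -
    have bc: "b = c" using that(3) flip flip[symmetric] by (auto simp: h_def split: if_splits)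
    then have "r i = r j" using that(3) flagD(3)[OF rX] by (auto simp: h_def split: if_splits) metis
    then show ?thesis using inj bc that by (metis linorder_neqE_nat)
  qed
  have rmod: "r (i mod N) = r i" for i
  proof (induction i)
    case (Suc i)
    show ?case
    proof (cases "Suc (i mod N) = N")
      case True
      then have "r (Suc i) = r N" using Suc by (metis rS)
      then show ?thesis using True N r0 by (simp add: mod_Suc)
    next
      case False
      then show ?thesis using Suc by (simp add: mod_Suc rS)
    qed
  qed simp
  have surj: "\<exists>i b. i < N \<and> y = h i b" if y: "y \<in> X" for y
  proof -
    have "card (X // con {}) = 1" using nb1 by (simp add: nb_def)
    then obtain C where C: "X // con {} = {C}" by (auto simp: card_1_singleton_iff)
    then have "con {} `` {x0} = con {} `` {y}" using x0 y by (metis quotientI singletonD)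
    then have "(x0, y) \<in> con {}" using orel_refl[OF y] by blast
    then have "y \<in> {h i b | i b. True}"
    proof (rule orel_closed)
      show "x0 \<in> {h i b | i b. True}" using r0 by (auto simp: h_def)
    next
      fix z assume "z \<in> {h i b | i b. True}"
      then obtain i b where z: "z = h i b" by blast
      have "e z = h i (\<not> b)" using z flagD(3)[OF rX] by (simp add: h_def)
      then show "sub_edge G {} z \<in> {h i b | i b. True}" by (auto simp: sub_edge_def)
      show "a z \<in> {h i b | i b. True}"
      proof (cases b)
        case True
        then have "a z = h (Suc i) False" using z by (simp add: h_def rS)
        then show ?thesis by blast
      next
        case False
        \<comment> \<open>Shifting by one period makes \<open>i + N - 1\<close> a genuine
          predecessor also for \<open>i = 0\<close>.\<close>
        have "r i = r (i + N)" using rmod[of i] rmod[of "i + N"] by simp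
        then have "a z = h (i + N - 1) True" using z False N ar[of "i + N - 1"] by (simp add: h_def)
        then show ?thesis by blast
      qed
    qed
    then obtain i b where "y = h i b" by blast
    then have "y = h (i mod N) b" using rmod by (simp add: h_def)
    moreover have "i mod N < N" using N(1) by simp
    ultimately show ?thesis by blast
  qed
  have "\<forall>i. \<exists>j b. j < N \<and> s (h i False) = h j b" using surj[OF flagD(4)[OF hX]] by blast
  then obtain \<pi> where "\<forall>i. \<exists>b. \<pi> i < N \<and> s (h i False) = h (\<pi> i) b" by (rule choice[THEN exE])
  then obtain b where \<pi>: "\<forall>i. \<pi> i < N \<and> s (h i False) = h (\<pi> i) (b i)" by (rule choice[THEN exE])
  define tw where "tw i = (\<not> b i)" for i
  have eh: "e (h i b) = h i (\<not> b)" for i b using flagD(3)[OF rX] by (simp add: h_def)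
  have "chord_diagram G N h \<pi> tw"
  proof unfold_locales
    show "bij_betw (\<lambda>(i, b). h i b) ({..<N} \<times> UNIV) X"
      unfolding bij_betw_def
    proof
      show "inj_on (\<lambda>(i, b). h i b) ({..<N} \<times> UNIV)" using h_inj by (force intro!: inj_onI)
      show "(\<lambda>(i, b). h i b) ` ({..<N} \<times> UNIV) = X" using hX surj by force
    qed
    show "a (h i True) = h (Suc i mod N) False" for i
      using rmod[of "Suc i"] by (simp add: h_def rS)
    show "s (h i b) = h (\<pi> i) (b = tw i)" for i b
    proof (cases b)
      case True
      have "s (h i True) = e (s (h i False))" using flagD(10)[OF hX, of i False] by (simp add: eh)
      then show ?thesis using True \<pi> eh by (simp add: tw_def)
    qed (use \<pi> in \<open>simp add: tw_def\<close>)
  qed (use N \<pi> eh in auto)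
  then show ?thesis by blast
qed

end

subsection \<open>The bouquets of the family\<close>

context chord_diagram
begin

lemma con_gap_step:
  assumes P: "pclosed P" and i: "i < N"
  shows "(h (pred i) True, h i False) \<in> con (fl P)"
    and "i \<notin> P \<Longrightarrow> (h (pred i) True, h i True) \<in> con (fl P)"
    and "i \<in> P \<Longrightarrow> \<not> tw i \<Longrightarrow> (h (pred i) True, h (\<pi> i) True) \<in> con (fl P)"
proof -
  note cl = edge_closed_fl[OF P]
  have PN: "P \<subseteq> {..<N}" using P by (simp add: pclosed_def)
  show 1: "(h (pred i) True, h i False) \<in> con (fl P)"
    using con_sym[OF cl con_arc[OF cl h_in[OF i, of False]]] arc_False[OF i] by simp
  show "(h (pred i) True, h i True) \<in> con (fl P)" if "i \<notin> P"
    using orel_trans[OF 1 con_end[OF cl h_in[OF i, of False]]] that end_h[OF i] h_in_fl[OF PN i] by simp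
  show "(h (pred i) True, h (\<pi> i) True) \<in> con (fl P)" if "i \<in> P" "\<not> tw i"
    using orel_trans[OF 1 con_side[OF cl]] that side_h[OF i] h_in_fl[OF PN i] by simp
qed

lemma edge_closed_eq_fl:
  assumes A: "edge_closed G A"
  shows "\<exists>P. pclosed P \<and> A = fl P"
proof (intro exI conjI)
  let ?P = "{i. i < N \<and> h i True \<in> A}"
  have mem: "h i b \<in> A \<longleftrightarrow> h i True \<in> A" if i: "i < N" for i b
    using edge_closedD(2)[OF A, of "h i b"] edge_closedD(2)[OF A, of "h i True"] end_h[OF i]
    by (cases b) auto
  show "pclosed ?P"
    unfolding pclosed_def
  proof (intro conjI subsetI)
    fix l assume "l \<in> \<pi> ` ?P"
    then obtain i where i: "i < N" "h i True \<in> A" "l = \<pi> i" by blast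
    then have "h l (True = tw i) \<in> A" using edge_closedD(3)[OF A i(2)] side_h by simp
    then show "l \<in> ?P" using mem[OF partner_less[OF i(1)]] partner_less[OF i(1)] i(3) by blast
  qed simp
  show "A = fl ?P"
  proof (intro equalityI subsetI)
    fix x assume x: "x \<in> A"
    obtain i b where "i < N" "x = h i b" using edge_closedD(1)[OF A x] by (rule flag_cases)
    moreover have "i \<in> ?P" using calculation x mem by blast
    ultimately show "x \<in> fl ?P" using h_in_fl[of ?P i b] by auto
  next
    fix x assume "x \<in> fl ?P"
    then obtain i b where "i < N" "h i True \<in> A" "x = h i b" by (auto simp: fl_def)
    then show "x \<in> A" using mem by blast
  qed
qed

lemma nb_le_2:
  assumes P: "pclosed P" and pq: "p < N" "q < N"
    and all: "\<And>g. g < N \<Longrightarrow> (h g True, h p True) \<in> con (fl P) \<or> (h g True, h q True) \<in> con (fl P)"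
  shows "nb G (fl P) \<le> 2" and "(h p True, h q True) \<in> con (fl P) \<Longrightarrow> nb G (fl P) = 1"
proof -
  note cl = edge_closed_fl[OF P]
  let ?C = "\<lambda>i. con (fl P) `` {h i True}"
  note ec = equiv_class_eq[OF equiv_con[OF cl]]
  have "K = ?C p \<or> K = ?C q" if K: "K \<in> X // con (fl P)" for K
  proof -
    obtain x where x: "x \<in> X" "K = con (fl P) `` {x}" using K by (rule quotientE)
    obtain i b where i: "i < N" "x = h i b" using x(1) by (rule flag_cases)
    obtain g where g: "g < N" "(h g True, x) \<in> con (fl P)"
      using con_gap_step(1)[OF P i(1)] pred_less[OF i(1)] i orel_refl[OF h_in] by (cases b) auto
    then have "K = ?C g" using x ec by auto
    then show ?thesis using all[OF g(1)] ec by metis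
  qed
  then have sub: "X // con (fl P) \<subseteq> {?C p, ?C q}" by blast
  have "nb G (fl P) \<le> card {?C p, ?C q}"
    unfolding nb_def by (rule card_mono[OF _ sub]) simp
  also have "\<dots> \<le> 2" by (simp add: card_insert_if)
  finally show "nb G (fl P) \<le> 2" .
  show "nb G (fl P) = 1" if "(h p True, h q True) \<in> con (fl P)"
  proof -
    have "?C p \<in> X // con (fl P)" using h_in[OF pq(1)] by (rule quotientI)
    moreover have "?C p = ?C q" using that ec by metis
    ultimately have "X // con (fl P) = {?C p}" using sub by blast
    then show ?thesis by (simp add: nb_def)
  qed
qed

text \<open>
  With all chords through the centre, the boundary walk from arc to arc advances by one modulo
  \<open>t\<close>; the labelling \<open>k\<close> records in which half it is, so the two halves meet on a single curve
  exactly if the number of chords is even.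
\<close>

lemma nb_all_crossing:
  assumes Nt: "N = 2 * t" and \<pi>: "\<And>i. i < N \<Longrightarrow> \<pi> i = (if i < t then i + t else i - t)"
    and ntw: "\<And>i. i < N \<Longrightarrow> \<not> tw i" and P: "pclosed P"
  shows "nb G (fl P) = (if even (card (P \<inter> {..<t})) then 1 else 2)"
proof -
  have t: "0 < t" using N Nt by simp
  have PN: "P \<subseteq> {..<N}" and P\<pi>: "\<And>i. i \<in> P \<Longrightarrow> \<pi> i \<in> P" using P by (auto simp: pclosed_def)
  have half: "g mod t = (if g < t then g else g - t)" if "g < N" for g
    using that Nt by (simp add: le_mod_geq)
  \<comment> \<open>Counts the half-edges of \<open>P\<close> that the walk from arc
    \<open>g\<close> still has to pass before the end of a half. Each makes it change halves, so
    \<open>k g\<close> says that it arrives on arc \<open>t - 1\<close> and not on arc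
    \<open>2 * t - 1\<close>.\<close>
  define n where "n g = card (P \<inter> {Suc (g mod t)..<t})" for g
  define k where "k g \<longleftrightarrow> even (n g) = (g < t)" for g
  have \<pi>mod: "\<pi> i mod t = i mod t" and \<pi>t: "(\<pi> i < t) = (\<not> i < t)" if "i < N" for i
    using \<pi>[OF that] half[OF that] half[of "\<pi> i"] partner_less[OF that] that Nt by auto
  have k\<pi>: "k (\<pi> i) = (\<not> k i)" if "i < N" for i
    using \<pi>mod[OF that] \<pi>t[OF that] by (auto simp: k_def n_def)
  have P_iff: "(i mod t \<in> P) = (i \<in> P)" if "i < N" for i
  proof (cases "i < t")
    case False
    then have "i mod t = \<pi> i" using \<pi>[OF that] half[OF that] by simp
    then show ?thesis using P\<pi>[of i] P\<pi>[of "\<pi> i"] partner(1)[OF that] by auto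
  qed simp
  have split: "card (P \<inter> {l..<t}) = card (P \<inter> {Suc l..<t}) + (if l \<in> P then 1 else 0)" if "l < t" for l
  proof -
    have "{l..<t} = insert l {Suc l..<t}" using that by auto
    then show ?thesis by simp
  qed
  have step: "k (pred i) = (k i \<noteq> (i \<in> P))" if i: "i < N" "i \<noteq> 0" "i \<noteq> t" for i
  proof -
    have pr: "pred i = i - 1" using i by (simp add: pred_def)
    have m: "Suc (pred i mod t) = i mod t" "(pred i < t) = (i < t)"
      unfolding pr using i Nt half[OF i(1)] half[of "i - 1"] by auto
    have "n (pred i) = n i + (if i \<in> P then 1 else 0)"
      unfolding n_def m using split[of "i mod t"] t P_iff[OF i(1)] by simp
    then show ?thesis using m(2) by (auto simp: k_def)
  qed
  have ends: "k (t - 1)" "\<not> k (2 * t - 1)"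
  proof -
    have "2 * t - 1 = (t - 1) + t" using t by simp
    then have "(2 * t - 1) mod t = t - 1" using t by (simp only: mod_add_self2) simp
    then show "k (t - 1)" "\<not> k (2 * t - 1)" using t by (auto simp: k_def n_def)
  qed
  have "{..<t} = {0..<t}" by auto
  then have tot: "card (P \<inter> {..<t}) = n 0 + (if 0 \<in> P then 1 else 0)"
    using split[of 0] t by (simp add: n_def)
  have k0: "(k 0 \<noteq> (0 \<in> P)) = even (card (P \<inter> {..<t}))"
    unfolding tot using t by (auto simp: k_def)
  have \<pi>0: "\<pi> 0 = t" "\<pi> t = 0" using \<pi>[of 0] \<pi>[of t] t Nt by auto
  have kt: "k t = (\<not> k 0)" "(t \<in> P) = (0 \<in> P)" using k\<pi>[of 0] \<pi>0 N P\<pi>[of 0] P\<pi>[of t] by auto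
  define c where "c b = (if b then t - 1 else 2 * t - 1)" for b :: bool
  have cN: "c b < N" for b using t Nt by (auto simp: c_def)
  have walk: "(h g True, h (c (k g)) True) \<in> con (fl P)" if "g < N" for g
    using that
  proof (induction "t - g mod t" arbitrary: g rule: less_induct)
    case less
    show ?case
    proof (cases "g = t - 1 \<or> g = 2 * t - 1")
      case True
      then have "c (k g) = g" using ends by (auto simp: c_def)
      then show ?thesis using orel_refl[OF h_in[OF less.prems]] by simp
    next
      case False
      let ?i = "Suc g"
      have "pred ?i = g" by (simp add: pred_def)
      moreover have "?i < N" "?i \<noteq> t" using False less.prems Nt by auto
      ultimately have i: "?i < N" "?i \<noteq> 0" "?i \<noteq> t" "pred ?i = g" by simp_all
      have m: "?i mod t = Suc (g mod t)" "Suc (g mod t) < t"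
        using i(1,3) Nt half[OF i(1)] half[OF less.prems] by (auto split: if_splits)
      have lt: "t - ?i mod t < t - g mod t" using m by simp
      note gs = con_gap_step[OF P i(1), unfolded i(4)]
      show ?thesis
      proof (cases "?i \<in> P")
        case True
        have "(h (\<pi> ?i) True, h (c (k (\<pi> ?i))) True) \<in> con (fl P)"
          using less.hyps[of "\<pi> ?i"] lt \<pi>mod[OF i(1)] partner_less[OF i(1)] by simp
        moreover have "k (\<pi> ?i) = k g" using step[OF i(1-3)] k\<pi>[OF i(1)] True i(4) by simp
        ultimately show ?thesis using orel_trans[OF gs(3)[OF True ntw[OF i(1)]]] by simp
      next
        case False
        have "(h ?i True, h (c (k ?i)) True) \<in> con (fl P)"
          using less.hyps[of ?i] lt i(1) by simp
        moreover have "k ?i = k g" using step[OF i(1-3)] False i(4) by simp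
        ultimately show ?thesis using orel_trans[OF gs(2)[OF False]] by simp
      qed
    qed
  qed
  have all: "(h g True, h (c True) True) \<in> con (fl P) \<or> (h g True, h (c False) True) \<in> con (fl P)"
    if "g < N" for g using walk[OF that] by (cases "k g") auto
  note le2 = nb_le_2[OF P cN cN all]
  show ?thesis
  proof (cases "even (card (P \<inter> {..<t}))")
    case True
    \<comment> \<open>From the last arc the walk enters the first half and then changes halves once
      for each chord of \<open>P\<close>; an even number of changes ends on arc
      \<open>t - 1\<close>.\<close>
    have p0: "pred 0 = c False" by (simp add: pred_def c_def flip: Nt)
    note gs = con_gap_step[OF P N, unfolded p0]
    have "(h (c False) True, h (c True) True) \<in> con (fl P)"
    proof (cases "0 \<in> P")
      case z: True
      then have "k t" using k0 True kt by simp
      then show ?thesis using orel_trans[OF gs(3)[OF z ntw[OF N]]] walk[of t] \<pi>0 Nt t by simp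
    next
      case False
      then have "k 0" using k0 True by simp
      then show ?thesis using orel_trans[OF gs(2)[OF False]] walk[OF N] by simp
    qed
    then show ?thesis using le2(2) con_sym[OF edge_closed_fl[OF P]] True by simp
  next
    case False
    \<comment> \<open>For an odd number the step equation also holds across the seams at 0 and
      \<open>t\<close>. Then \<open>k\<close> is constant on boundary curves and separates the last
      arcs of the two halves.\<close>
    have step': "k (pred i) = (k i \<noteq> (i \<in> P))" if i: "i < N" for i
    proof -
      have "pred 0 = 2 * t - 1" "pred t = t - 1" using t by (auto simp: pred_def simp flip: Nt)
      then show ?thesis using step[OF i] k0 False ends kt by (cases "i = 0 \<or> i = t") auto
    qed
    have "(h (c True) True, h (c False) True) \<notin> con (fl P)"
    proof
      assume r: "(h (c True) True, h (c False) True) \<in> con (fl P)"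
      have "k (if True then c True else pred (c True)) = k (if True then c False else pred (c False))"
      proof (rule con_invariant[OF P _ _ _ cN cN r])
        fix i assume i: "i \<in> P"
        then have iN: "i < N" using PN by auto
        show "k i = k (pred (\<pi> i))"
          using step'[OF partner_less[OF iN]] k\<pi>[OF iN] P\<pi>[OF i] by simp
        assume "tw i"
        then show "k i = k (\<pi> i) \<and> k (pred i) = k (pred (\<pi> i))" using ntw[OF iN] by simp
      qed (use step' in auto)
      then show False using ends by (simp add: c_def)
    qed
    then have "nb G (fl P) \<ge> 2" by (rule nb_ge_2[OF edge_closed_fl[OF P] h_in[OF cN] h_in[OF cN]])
    then show ?thesis using le2(1) False by simp
  qed
qed

lemma Diff_fl_pos:
  assumes "pclosed P"
  shows "pclosed ({..<N} - P)" "X - fl P = fl ({..<N} - P)"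
proof -
  have PN: "P \<subseteq> {..<N}" and P\<pi>: "\<And>i. i \<in> P \<Longrightarrow> \<pi> i \<in> P" using assms by (auto simp: pclosed_def)
  have "\<pi> i \<notin> P" if "i < N" "i \<notin> P" for i using P\<pi>[of "\<pi> i"] partner(1)[OF that(1)] that by auto
  then show "pclosed ({..<N} - P)" using partner_less by (auto simp: pclosed_def)
  show "X - fl P = fl ({..<N} - P)"
  proof (intro equalityI subsetI)
    fix x assume x: "x \<in> X - fl P"
    then obtain i b where "i < N" "x = h i b" using flag_cases by blast
    then show "x \<in> fl ({..<N} - P)" using x h_in_fl[OF PN] h_in_fl[of "{..<N} - P"] by auto
  next
    fix x assume "x \<in> fl ({..<N} - P)"
    then obtain i b where "i < N" "i \<notin> P" "x = h i b" by (auto simp: fl_def)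
    then show "x \<in> X - fl P" using h_in h_in_fl[OF PN] by auto
  qed
qed

lemma const_sum_all_crossing:
  assumes Nt: "N = 2 * t" and \<pi>: "\<And>i. i < N \<Longrightarrow> \<pi> i = (if i < t then i + t else i - t)"
    and ntw: "\<And>i. i < N \<Longrightarrow> \<not> tw i" and t: "odd t"
  shows "const_sum G 3"
  unfolding const_sum_def
proof (intro allI impI)
  fix A assume "edge_closed G A"
  then obtain P where P: "pclosed P" "A = fl P" using edge_closed_eq_fl by blast
  have "card (({..<N} - P) \<inter> {..<t}) + card (P \<inter> {..<t}) = card {..<t}"
  proof (subst card_Un_disjoint[symmetric])
    show "card (({..<N} - P) \<inter> {..<t} \<union> P \<inter> {..<t}) = card {..<t}"
      using Nt by (intro arg_cong[of _ _ card]) auto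
  qed auto
  then have "even (card (({..<N} - P) \<inter> {..<t})) \<longleftrightarrow> odd (card (P \<inter> {..<t}))"
    using t by (metis card_lessThan even_add)
  then show "nb G A + nb G (X - A) = 3"
    using nb_all_crossing[OF Nt \<pi> ntw P(1)] nb_all_crossing[OF Nt \<pi> ntw Diff_fl_pos(1)[OF P(1)]]
      Diff_fl_pos(2)[OF P(1)] P(2) by simp
qed

lemma const_sum_single_twisted:
  assumes N2: "N = 2" and tw: "tw 0"
  shows "const_sum G 2"
  unfolding const_sum_def
proof (intro allI impI)
  fix A assume "edge_closed G A"
  then obtain P where P: "pclosed P" "A = fl P" using edge_closed_eq_fl by blast
  have \<pi>0: "\<pi> 0 = 1" using partner_less[OF N] partner(3)[OF N] N2 by auto
  then have \<pi>1: "\<pi> 1 = 0" using partner(1)[OF N] by simp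
  have all: "{..<N} = {0, \<pi> 0}" using N2 \<pi>0 by auto
  have "P = {} \<or> P = {..<N}"
  proof -
    have "P \<subseteq> {0, 1}" using P(1) N2 unfolding pclosed_def by auto
    moreover have "0 \<in> P \<longleftrightarrow> 1 \<in> P" using P(1) \<pi>0 \<pi>1 unfolding pclosed_def by force
    ultimately show ?thesis unfolding all \<pi>0 by blast
  qed
  then show "nb G A + nb G (X - A) = 2"
    using nb_twisted[OF N tw] nb_empty Diff_fl_pos(2)[OF P(1)] P(2) by (auto simp: all fl_empty)
qed

end

text \<open>Partner map and twists determine all three involutions in terms of the labels, so a
  bouquet is recognised by comparing positions.\<close>

lemma chord_diagram_equiv:
  assumes "chord_diagram G N h \<pi> tw" "chord_diagram H N h' \<pi>' tw'"
    and "\<And>i. i < N \<Longrightarrow> \<pi>' i = \<pi> i" "\<And>i. i < N \<Longrightarrow> tw' i = tw i"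
  shows "ribbon_equiv G H"
proof -
  interpret G: chord_diagram G N h \<pi> tw by fact
  interpret H: chord_diagram H N h' \<pi>' tw' by fact
  let ?I = "{..<N} \<times> (UNIV :: bool set)"
  let ?\<psi> = "inv_into ?I (\<lambda>(i, b). h i b)"
  let ?\<phi> = "(\<lambda>(i, b). h' i b) \<circ> ?\<psi>"
  have \<phi>: "?\<phi> (h i b) = h' i b" if "i < N" for i b
  proof -
    have "?\<psi> (h i b) = (i, b)"
      using bij_betw_inv_into_left[OF G.bij, of "(i, b)"] that by simp
    then show ?thesis by simp
  qed
  have "bij_betw ?\<phi> (flags G) (flags H)"
    by (rule bij_betw_trans[OF bij_betw_inv_into[OF G.bij] H.bij])
  moreover have "?\<phi> (ribbon_end G x) = ribbon_end H (?\<phi> x) \<and>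
      ?\<phi> (ribbon_side G x) = ribbon_side H (?\<phi> x) \<and> ?\<phi> (vertex_arc G x) = vertex_arc H (?\<phi> x)"
    if x: "x \<in> flags G" for x
  proof -
    obtain i b where i: "i < N" "x = h i b" using x by (rule G.flag_cases)
    have 1: "?\<phi> (ribbon_end G x) = ribbon_end H (?\<phi> x)"
      unfolding i(2) G.end_h[OF i(1)] \<phi>[OF i(1)] H.end_h[OF i(1)] ..
    have 2: "?\<phi> (ribbon_side G x) = ribbon_side H (?\<phi> x)"
      unfolding i(2) G.side_h[OF i(1)] \<phi>[OF i(1)] \<phi>[OF G.partner_less[OF i(1)]] H.side_h[OF i(1)] assms(3,4)[OF i(1)] ..
    have 3: "?\<phi> (vertex_arc G x) = vertex_arc H (?\<phi> x)"
    proof (cases b)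
      case True
      then have x: "x = h i True" using i(2) by simp
      have "Suc i mod N < N" using G.N by simp
      then show ?thesis unfolding x G.arc_True[OF i(1)] \<phi>[OF i(1)] H.arc_True[OF i(1)] by (rule \<phi>)
    next
      case False
      then have x: "x = h i False" using i(2) by simp
      show ?thesis
        unfolding x G.arc_False[OF i(1)] \<phi>[OF i(1)] H.arc_False[OF i(1)]
        by (rule \<phi>[OF G.pred_less[OF i(1)]])
    qed
    show ?thesis using 1 2 3 by blast
  qed
  ultimately show ?thesis unfolding ribbon_equiv_def by blast
qed

lemma chord_diagram_bouquet_of:
  assumes n: "length w = n" "0 < n"
    and p: "\<And>i. i < n \<Longrightarrow> partner w i < n \<and> partner w i \<noteq> i \<and> partner w (partner w i) = i"
  shows "chord_diagram (bouquet_of w) n Pair (partner w) (\<lambda>i. snd (w ! partner w i) \<noteq> snd (w ! i))"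
proof -
  have fl: "flags (bouquet_of w) = {..<n} \<times> UNIV"
    and re: "\<And>i b. ribbon_end (bouquet_of w) (i, b) = (i, \<not> b)"
    and rs: "\<And>i b. ribbon_side (bouquet_of w) (i, b) =
      (partner w i, b = (snd (w ! partner w i) \<noteq> snd (w ! i)))"
    and ar: "\<And>i b. vertex_arc (bouquet_of w) (i, b) =
      (if b then ((i + 1) mod n, False) else ((i + n - 1) mod n, True))"
    using n by (auto simp: bouquet_of_def Let_def)
  have m1: "(Suc i mod n + n - Suc 0) mod n = i" if "i < n" for i
    using that by (cases "Suc i = n") auto
  have m2: "Suc ((i + n - Suc 0) mod n) mod n = i" if "i < n" for i
  proof -
    have "Suc ((i + n - Suc 0) mod n) mod n = Suc (i + n - Suc 0) mod n" by (rule mod_Suc_eq)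
    then show ?thesis using that n by simp
  qed
  have rg: "is_ribbon_graph (bouquet_of w)"
    unfolding is_ribbon_graph_def
  proof (intro conjI ballI)
    show "ffi (flags (bouquet_of w)) (ribbon_end (bouquet_of w))"
      unfolding fixpoint_free_involution_on_def fl by (auto simp: re)
    show "ffi (flags (bouquet_of w)) (ribbon_side (bouquet_of w))"
      unfolding fixpoint_free_involution_on_def fl
    proof
      fix x assume "x \<in> {..<n} \<times> (UNIV :: bool set)"
      then obtain i b where x: "x = (i, b)" "i < n" by auto
      show "ribbon_side (bouquet_of w) x \<in> {..<n} \<times> UNIV \<and> ribbon_side (bouquet_of w) x \<noteq> x \<and>
          ribbon_side (bouquet_of w) (ribbon_side (bouquet_of w) x) = x"
        using p[OF x(2)] by (auto simp: x(1) rs)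
    qed
    show "ffi (flags (bouquet_of w)) (vertex_arc (bouquet_of w))"
      unfolding fixpoint_free_involution_on_def fl
    proof
      fix x assume "x \<in> {..<n} \<times> (UNIV :: bool set)"
      then obtain i b where x: "x = (i, b)" "i < n" by auto
      show "vertex_arc (bouquet_of w) x \<in> {..<n} \<times> UNIV \<and> vertex_arc (bouquet_of w) x \<noteq> x \<and>
          vertex_arc (bouquet_of w) (vertex_arc (bouquet_of w) x) = x"
        using m1[OF x(2)] m2[OF x(2)] n(2) by (cases b) (simp_all add: x(1) ar)
    qed
    fix x assume "x \<in> flags (bouquet_of w)"
    then obtain i b where x: "x = (i, b)" "i < n" using fl by auto
    show "ribbon_end (bouquet_of w) (ribbon_side (bouquet_of w) x) =
        ribbon_side (bouquet_of w) (ribbon_end (bouquet_of w) x)"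
      by (auto simp: x(1) re rs)
    show "ribbon_end (bouquet_of w) (ribbon_side (bouquet_of w) x) \<noteq> x"
      using p[OF x(2)] by (simp add: x(1) re rs)
  qed (simp add: fl)
  show ?thesis
  proof unfold_locales
    show "bij_betw (\<lambda>(i, b). (i, b)) ({..<n} \<times> UNIV) (flags (bouquet_of w))"
      by (simp add: fl bij_betw_def inj_on_def)
  qed (use rg n p in \<open>auto simp: re rs ar\<close>)
qed

lemma chord_diagram_B_twisted:
  "\<exists>\<pi> tw. chord_diagram B_twisted 2 Pair \<pi> tw \<and> tw 0 \<and> tw 1"
proof -
  let ?w = "[(1, Plus), (1, Minus)] :: signed_rotation"
  have p0: "partner ?w 0 = 1"
    unfolding partner_def by (rule the_equality) (auto simp: less_Suc_eq numeral_2_eq_2)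
  have p1: "partner ?w 1 = 0"
    unfolding partner_def by (rule the_equality) (auto simp: less_Suc_eq numeral_2_eq_2)
  have "chord_diagram (bouquet_of ?w) 2 Pair (partner ?w) (\<lambda>i. snd (?w ! partner ?w i) \<noteq> snd (?w ! i))"
  proof (rule chord_diagram_bouquet_of)
    fix i :: nat assume "i < 2"
    then consider "i = 0" | "i = 1" by linarith
    then show "partner ?w i < 2 \<and> partner ?w i \<noteq> i \<and> partner ?w (partner ?w i) = i"
      using p0 p1 by cases auto
  qed auto
  moreover have "snd (?w ! partner ?w 0) \<noteq> snd (?w ! 0)" "snd (?w ! partner ?w 1) \<noteq> snd (?w ! 1)"
    using p0 p1 by simp_all
  ultimately show ?thesis unfolding B_twisted_def by blast
qed

lemma chord_diagram_B_untwisted: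
  assumes t: "0 < t"
  shows "\<exists>\<pi> tw. chord_diagram (B_untwisted t) (2 * t) Pair \<pi> tw \<and>
    (\<forall>i < 2 * t. \<pi> i = (if i < t then i + t else i - t) \<and> \<not> tw i)"
proof -
  let ?w = "map (\<lambda>i. (i, Plus)) ([1..<t + 1] @ [1..<t + 1])"
  have len: "length ?w = 2 * t" by simp
  have nth: "?w ! i = (if i < t then i + 1 else i - t + 1, Plus)" if "i < 2 * t" for i
    using that by (auto simp: nth_append nth_map simp del: upt_Suc)
  have p: "partner ?w i = (if i < t then i + t else i - t)" if i: "i < 2 * t" for i
    unfolding partner_def len
  proof (rule the_equality)
    show "(if i < t then i + t else i - t) < 2 * t \<and> (if i < t then i + t else i - t) \<noteq> i \<and>
        fst (?w ! (if i < t then i + t else i - t)) = fst (?w ! i)"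
      using nth[OF i] nth[of "if i < t then i + t else i - t"] i t by auto
  next
    fix j assume j: "j < 2 * t \<and> j \<noteq> i \<and> fst (?w ! j) = fst (?w ! i)"
    then have "(if j < t then j else j - t) = (if i < t then i else i - t)"
      using nth[OF i] nth[of j] by auto
    then show "j = (if i < t then i + t else i - t)" using i j by (auto split: if_splits)
  qed
  have "chord_diagram (bouquet_of ?w) (2 * t) Pair (partner ?w) (\<lambda>i. snd (?w ! partner ?w i) \<noteq> snd (?w ! i))"
  proof (rule chord_diagram_bouquet_of[OF len])
    fix i assume i: "i < 2 * t"
    then have "partner ?w i < 2 * t" using p by auto
    then show "partner ?w i < 2 * t \<and> partner ?w i \<noteq> i \<and> partner ?w (partner ?w i) = i"
      using p[OF i] p[of "partner ?w i"] i t by (auto split: if_splits)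
  qed (use t in auto)
  moreover have "\<not> snd (?w ! partner ?w i) \<noteq> snd (?w ! i)" if "i < 2 * t" for i
    using nth[OF that] nth[of "partner ?w i"] p[OF that] that by auto
  ultimately show ?thesis unfolding B_untwisted_def using p by blast
qed

lemma const_sum_equiv_B_twisted:
  assumes "is_ribbon_graph P" "ribbon_equiv P B_twisted"
  shows "const_sum P 2"
proof -
  obtain \<pi> tw where c: "chord_diagram B_twisted 2 Pair \<pi> tw" "tw 0" using chord_diagram_B_twisted by blast
  show ?thesis
    by (rule const_sum_equiv_imp[OF assms chord_diagram.const_sum_single_twisted[OF c(1) refl c(2)]])
qed

lemma const_sum_equiv_B_untwisted:
  assumes "is_ribbon_graph P" "ribbon_equiv P (B_untwisted t)" "odd t"
  shows "const_sum P 3"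
proof -
  obtain \<pi> tw where c: "chord_diagram (B_untwisted t) (2 * t) Pair \<pi> tw"
    "\<And>i. i < 2 * t \<Longrightarrow> \<pi> i = (if i < t then i + t else i - t)" "\<And>i. i < 2 * t \<Longrightarrow> \<not> tw i"
    using chord_diagram_B_untwisted[OF odd_pos[OF assms(3)]] by blast
  have "const_sum (B_untwisted t) 3"
    by (rule chord_diagram.const_sum_all_crossing[OF c(1) refl c(2,3) assms(3)])
  then show ?thesis by (rule const_sum_equiv_imp[OF assms(1,2)])
qed

text \<open>Beyond 2, a twisted loop contributes 0 and an untwisted factor 1; each join subtracts
  the surplus 2, so the contributions add up.\<close>

lemma const_sum_iterated_join:
  assumes "iterated_ribbon_join Ps R" "\<forall>P\<in>set Ps. \<exists>C\<in>B_family. ribbon_equiv P C"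
  shows "is_ribbon_graph R \<and> const_sum R (2 + length (filter (\<lambda>P. \<not> ribbon_equiv P B_twisted) Ps))"
  using assms
proof (induction rule: iterated_ribbon_join.induct)
  case (single P)
  show ?case
  proof (cases "ribbon_equiv P B_twisted")
    case True
    then show ?thesis using single const_sum_equiv_B_twisted by simp
  next
    case False
    then obtain t where "odd t" "ribbon_equiv P (B_untwisted t)" using single by (auto simp: B_family_def)
    then show ?thesis using single False const_sum_equiv_B_untwisted by (simp add: numeral_3_eq_3)
  qed
next
  case (join Ps P Qs Q x y)
  interpret join_setup P Q x y
    by unfold_locales (use join in auto)
  show ?case using join is_ribbon_graph_J const_sum_join by fastforce
qed

subsection \<open>Cutting a bouquet along an interval of its rotation\<close>

text \<open>Equality up to the arbitrary values outside the corners. Cutting and joining reproduces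
  a graph only in this sense, and unlike an equivalence it keeps the corners in place, so factors
  can be replaced inside a join.\<close>

definition agree :: "'a ribbon_graph \<Rightarrow> 'a ribbon_graph \<Rightarrow> bool" where
  "agree G H \<longleftrightarrow> flags G = flags H \<and>
     (\<forall>x\<in>flags G. ribbon_end G x = ribbon_end H x \<and> ribbon_side G x = ribbon_side H x \<and>
                  vertex_arc G x = vertex_arc H x)"

lemma agree_ribbon_equiv: "agree G H \<Longrightarrow> ribbon_equiv G H"
  unfolding ribbon_equiv_def agree_def by (intro exI[of _ id]) (auto simp: bij_betw_def)

lemma agree_nb: "agree G H \<Longrightarrow> nb G A = nb H A"
proof -
  assume "agree G H"
  then have "bd_rel G A = bd_rel H A" "flags G = flags H"
    using orel_cong[of "flags G" "sub_edge G A" "sub_edge H A" "vertex_arc G" "vertex_arc H"]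
    by (auto simp: agree_def sub_edge_def)
  then show ?thesis by (simp add: nb_def)
qed

lemma agree_edge_closed: "agree G H \<Longrightarrow> edge_closed G A = edge_closed H A"
  unfolding agree_def edge_closed_def by (metis subsetD)

lemma agree_const_sum: "agree G H \<Longrightarrow> const_sum G c = const_sum H c"
  using agree_nb[of G H] agree_edge_closed[of G H] by (simp add: const_sum_def agree_def)

lemma agree_ribbon_join:
  assumes "agree P P'" "agree Q Q'" "x \<in> flags P" "y \<in> flags Q" "flags P \<inter> flags Q = {}"
  shows "agree (ribbon_join P x Q y) (ribbon_join P' x Q' y)"
  using assms unfolding agree_def ribbon_join_def by auto

lemma agree_trans: "agree G H \<Longrightarrow> agree H K \<Longrightarrow> agree G K"
  by (auto simp: agree_def)

context ribbon_graph
begin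

text \<open>Only the arcs at \<open>u\<close> and \<open>v\<close> leave \<open>Y\<close>. Closing
  them up by an arc from \<open>u\<close> to \<open>v\<close> inside and one from \<open>a u\<close>
  to \<open>a v\<close> outside gives the factors; joining at \<open>u\<close> and
  \<open>a u\<close> restores both original arcs.\<close>

lemma cut_two_arcs:
  assumes Y: "edge_closed G Y" and uv: "u \<in> Y" "v \<in> Y" "u \<noteq> v" "a u \<notin> Y" "a v \<notin> Y"
    and inn: "\<And>z. z \<in> Y \<Longrightarrow> z \<noteq> u \<Longrightarrow> z \<noteq> v \<Longrightarrow> a z \<in> Y"
  shows "\<exists>P Q. is_ribbon_graph P \<and> is_ribbon_graph Q \<and> flags P = Y \<and> flags Q = X - Y \<and>
    agree G (ribbon_join P u Q (a u))"
proof (intro exI conjI)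
  let ?P = "G\<lparr>flags := Y, vertex_arc := a(u := v, v := u)\<rparr>"
  let ?Q = "G\<lparr>flags := X - Y, vertex_arc := a(a u := a v, a v := a u)\<rparr>"
  show "flags ?P = Y" "flags ?Q = X - Y" by simp_all
  have YX: "Y \<subseteq> X" using Y by (simp add: edge_closed_def)
  have uX: "u \<in> X" "v \<in> X" using uv YX by auto
  have ne: "a u \<noteq> a v" using flagD(9)[OF uX(1)] flagD(9)[OF uX(2)] uv(3) by metis
  have P: "ffi Y (a(u := v, v := u))"
    unfolding fixpoint_free_involution_on_def
  proof
    fix z assume z: "z \<in> Y"
    show "(a(u := v, v := u)) z \<in> Y \<and> (a(u := v, v := u)) z \<noteq> z \<and>
        (a(u := v, v := u)) ((a(u := v, v := u)) z) = z"
    proof (cases "z = u \<or> z = v")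
      case False
      have zX: "z \<in> X" using z YX by auto
      have "a z \<noteq> u" "a z \<noteq> v" using flagD(9)[OF zX] z uv by auto
      then show ?thesis using False inn[OF z] flagD(8,9)[OF zX] by auto
    qed (use uv in auto)
  qed
  have Q: "ffi (X - Y) (a(a u := a v, a v := a u))"
    unfolding fixpoint_free_involution_on_def
  proof
    fix z assume z: "z \<in> X - Y"
    show "(a(a u := a v, a v := a u)) z \<in> X - Y \<and> (a(a u := a v, a v := a u)) z \<noteq> z \<and>
        (a(a u := a v, a v := a u)) ((a(a u := a v, a v := a u)) z) = z"
    proof (cases "z = a u \<or> z = a v")
      case True
      then show ?thesis using uv uX flagD(7) ne by auto
    next
      case False
      have zX: "z \<in> X" using z by auto
      have "a z \<noteq> u" "a z \<noteq> v" using flagD(9)[OF zX] False by auto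
      moreover have "a z \<notin> Y" using inn[of "a z"] calculation flagD(9)[OF zX] z by auto
      moreover have "a z \<noteq> a u" "a z \<noteq> a v" using flagD(9)[OF zX] flagD(9)[OF uX(1)] flagD(9)[OF uX(2)] z uv(1,2)
        by (metis DiffD2)+
      ultimately show ?thesis using False flagD(7-9)[OF zX] by auto
    qed
  qed
  have c1: "ffi Y e" "ffi Y s"
    using edge_closedD[OF Y] flagD YX unfolding fixpoint_free_involution_on_def by auto
  have c2: "ffi (X - Y) e" "ffi (X - Y) s"
    using edge_closedD[OF edge_closed_Diff[OF edge_closed_flags Y]] flagD
    unfolding fixpoint_free_involution_on_def by auto
  have es: "\<forall>x\<in>X. e (s x) = s (e x) \<and> e (s x) \<noteq> x" using flagD by simp
  show "is_ribbon_graph ?P"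
    unfolding is_ribbon_graph_def using c1 P es YX finite_subset[OF YX finX] by auto
  show "is_ribbon_graph ?Q"
    unfolding is_ribbon_graph_def using c2 Q es finX by auto
  show "agree G (ribbon_join ?P u ?Q (a u))"
    unfolding agree_def ribbon_join_def
    using YX uv ne flagD(9)[OF uX(1)] flagD(9)[OF uX(2)] by auto
qed

lemma nb_pos:
  assumes "edge_closed G A" "X \<noteq> {}"
  shows "0 < nb G A"
proof -
  obtain x where x: "x \<in> X" using assms by blast
  have "card {x} \<le> card (X // con A)"
    by (rule finite_quotient_card_ge[OF equiv_con[OF assms(1)] finX]) (use x in auto)
  then show ?thesis by (simp add: nb_def)
qed

end

context const_chord_diagram
begin

lemma cut_interval:
  assumes uq: "0 < u" "u < q" "q \<le> N" "\<pi> ` {u..<q} \<subseteq> {u..<q}"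
  shows "\<exists>P Q x y. is_ribbon_graph P \<and> is_ribbon_graph Q \<and> x \<in> flags P \<and> y \<in> flags Q \<and>
    flags P \<inter> flags Q = {} \<and> agree G (ribbon_join P x Q y)"
proof -
  let ?I = "{u..<q}"
  have IN: "?I \<subseteq> {..<N}" using uq by auto
  have Y: "edge_closed G (fl ?I)" by (rule edge_closed_fl) (use uq in \<open>auto simp: pclosed_def\<close>)
  have uN: "u < N" "q - 1 < N" using uq by auto
  have au: "a (h u False) = h (u - 1) True" using arc_False[OF uN(1)] uq by (simp add: pred_def)
  have av: "a (h (q - 1) True) = h (q mod N) False" using arc_True[OF uN(2)] uq by simp
  have u1: "u - 1 < N" "u - 1 \<notin> ?I" using uq by auto
  \<comment> \<open>For \<open>q = N\<close> the arc leads to position 0, which is outside the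
    interval because \<open>0 < u\<close>.\<close>
  have q1: "q mod N < N" "q mod N \<notin> ?I" using uq by (cases "q = N"; auto)+
  have "a z \<in> fl ?I" if z: "z \<in> fl ?I" "z \<noteq> h u False" "z \<noteq> h (q - 1) True" for z
  proof -
    obtain i b where i: "i \<in> ?I" "z = h i b" using z(1) by (auto simp: fl_def)
    have iN: "i < N" using i IN by auto
    show ?thesis
    proof (cases b)
      case True
      then have "Suc i < q" using i z(3) by (cases "Suc i = q") auto
      then show ?thesis using True i arc_True[OF iN] uq by (auto simp: fl_def)
    next
      case False
      then have "u < i" using i z(2) by (cases "i = u") auto
      then have "a z = h (i - 1) True" using False i(2) arc_False[OF iN] by (simp add: pred_def)
      then show ?thesis using h_in_fl[OF IN, of "i - 1" True] \<open>u < i\<close> i(1) iN by auto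
    qed
  qed
  moreover have "h u False \<in> fl ?I" "h (q - 1) True \<in> fl ?I" using uq by (auto simp: fl_def)
  moreover have "h u False \<noteq> h (q - 1) True" using h_eq[OF uN] by simp
  moreover have "a (h u False) \<notin> fl ?I" unfolding au using h_in_fl[OF IN u1(1)] u1(2) by simp
  moreover have "a (h (q - 1) True) \<notin> fl ?I" unfolding av using h_in_fl[OF IN q1(1)] q1(2) by simp
  ultimately obtain P Q where PQ: "is_ribbon_graph P" "is_ribbon_graph Q" "flags P = fl ?I" "flags Q = X - fl ?I"
      "agree G (ribbon_join P (h u False) Q (a (h u False)))"
    using cut_two_arcs[OF Y, of "h u False" "h (q - 1) True"] by blast
  have "a (h u False) \<in> flags Q" "h u False \<in> flags P"
    using PQ(3,4) \<open>a (h u False) \<notin> fl ?I\<close> \<open>h u False \<in> fl ?I\<close> flagD(7)[OF h_in[OF uN(1)]] by auto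
  moreover have "flags P \<inter> flags Q = {}" using PQ by auto
  ultimately show ?thesis using PQ by blast
qed

lemma all_linked_in_family:
  assumes all: "\<And>j. j < N \<Longrightarrow> linked 0 j"
  shows "\<exists>C\<in>B_family. ribbon_equiv G C"
proof (cases "tw 0")
  case True
  then have two: "j = 0 \<or> j = \<pi> 0" if "j < N" for j using linked_iff[OF N that] all[OF that] by simp
  have N2: "N = 2"
  proof (rule ccontr)
    assume "N \<noteq> 2"
    moreover have "N \<noteq> 1" using partner_less[OF N] partner(3)[OF N] by auto
    ultimately have "1 < N" "2 < N" using N by auto
    then show False using two[of 1] two[of 2] by auto
  qed
  have \<pi>: "\<pi> 0 = 1" "\<pi> 1 = 0" using two[of 1] partner(1)[OF N] N2 by auto
  obtain \<pi>' tw' where c: "chord_diagram B_twisted 2 Pair \<pi>' tw'" "tw' 0" "tw' 1"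
    using chord_diagram_B_twisted by blast
  interpret C: chord_diagram B_twisted 2 Pair \<pi>' tw' by fact
  have \<pi>': "\<pi>' 0 = 1" "\<pi>' 1 = 0"
    using C.partner_less[of 0] C.partner(3)[of 0] C.partner_less[of 1] C.partner(3)[of 1] by auto
  have tws: "tw 1" using partner(2)[OF N] True \<pi> by simp
  have "ribbon_equiv G B_twisted"
  proof (rule chord_diagram_equiv[OF _ c(1)])
    show "chord_diagram G 2 h \<pi> tw" using chord_diagram_axioms N2 by simp
    fix i :: nat assume "i < 2"
    then consider "i = 0" | "i = 1" by linarith
    then show "\<pi>' i = \<pi> i" "tw' i = tw i" using \<pi> \<pi>' c(2,3) True tws by (cases, auto)+
  qed
  then show ?thesis by (auto simp: B_family_def)
next
  case False
  have ntw: "\<not> tw j" if "j < N" for j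
    using linked_iff[OF N that] all[OF that] False partner(2)[OF N] by auto
  have link: "linked i j" if "i < N" "j < N" for i j
    using linked_trans[OF that(1) N that(2) linked_sym[OF N that(1) all[OF that(1)]] all[OF that(2)]] .
  \<comment> \<open>Every other chord crosses that of \<open>i\<close>, so \<open>\<pi>\<close>
    exchanges the positions between its ends with those outside. Equal numbers on both sides place
    the ends diametrically.\<close>
  have half: "2 * (\<pi> i - i) = N" if i: "i < N" "i < \<pi> i" for i
  proof -
    let ?I = "{i<..<\<pi> i}" and ?O = "{..<i} \<union> {\<pi> i<..<N}"
    have pN: "\<pi> i < N" by (rule partner_less[OF i(1)])
    have cr: "btw i j \<noteq> btw i (\<pi> j)" "\<pi> j \<noteq> i" "\<pi> j \<noteq> \<pi> i" if "j < N" "j \<noteq> i" "j \<noteq> \<pi> i" for j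
      using link[OF i(1) that(1)] that partner(1)[OF that(1)] partner(1)[OF i(1)]
      by (auto simp: linked_def cross_def)
    have b: "btw i g \<longleftrightarrow> i < g \<and> g < \<pi> i" for g using i by (simp add: btw_def)
    have "bij_betw \<pi> ?I ?O"
    proof (rule bij_betw_byWitness[where f' = \<pi>])
      show "\<forall>j\<in>?I. \<pi> (\<pi> j) = j" "\<forall>j\<in>?O. \<pi> (\<pi> j) = j" using partner(1) i pN by auto
      show "\<pi> ` ?I \<subseteq> ?O"
      proof
        fix k assume "k \<in> \<pi> ` ?I"
        then obtain j where j: "k = \<pi> j" "j \<in> ?I" by (rule imageE)
        have jN: "j < N" "j \<noteq> i" "j \<noteq> \<pi> i" "btw i j" using j(2) pN unfolding b by auto
        show "k \<in> ?O" using cr[OF jN(1-3)] jN(4) b[of "\<pi> j"] partner_less[OF jN(1)] j(1) by auto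
      qed
      show "\<pi> ` ?O \<subseteq> ?I"
      proof
        fix k assume "k \<in> \<pi> ` ?O"
        then obtain j where j: "k = \<pi> j" "j \<in> ?O" by (rule imageE)
        have jN: "j < N" "j \<noteq> i" "j \<noteq> \<pi> i" "\<not> btw i j" using j(2) i(2) i(1) pN unfolding b by auto
        show "k \<in> ?I" using cr(1)[OF jN(1-3)] jN(4) unfolding j(1) b by auto
      qed
    qed
    then have "card ?I = card ?O" by (rule bij_betw_same_card)
    also have "\<dots> = i + (N - Suc (\<pi> i))"
      using i by (subst card_Un_disjoint) auto
    finally show ?thesis using i pN by simp
  qed
  have \<pi>0: "0 < \<pi> 0" using partner(3)[OF N] by simp
  define t where "t = \<pi> 0"
  have Nt: "N = 2 * t" using half[OF N \<pi>0] by (simp add: t_def)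
  have \<pi>: "\<pi> i = (if i < t then i + t else i - t)" if i: "i < N" for i
  proof (cases "i < \<pi> i")
    case True
    then have "\<pi> i = i + t" using half[OF i] Nt by simp
    then show ?thesis using partner_less[OF i] Nt by simp
  next
    case F: False
    then have lt: "\<pi> i < i" using partner(3)[OF i] by simp
    then have "i = \<pi> i + t" using half[OF partner_less[OF i]] partner(1)[OF i] Nt by simp
    then show ?thesis by simp
  qed
  have "odd t"
  proof
    assume ev: "even t"
    have P: "pclosed {..<N}" using partner_less by (auto simp: pclosed_def)
    have X: "fl {..<N} = X" using Diff_fl_pos(2)[OF pclosed_empty] by (simp add: fl_empty)
    have "{..<N} \<inter> {..<t} = {..<t}" using Nt by auto
    then have "nb G X = 1" using nb_all_crossing[OF Nt \<pi> ntw P] ev X by simp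
    then show False
      using nb_ge_2[OF edge_closed_flags h_in[OF N] h_in[OF N] untwisted_apart[OF N ntw[OF N]]] by simp
  qed
  obtain \<pi>' tw' where c: "chord_diagram (B_untwisted t) (2 * t) Pair \<pi>' tw'"
    "\<And>i. i < 2 * t \<Longrightarrow> \<pi>' i = (if i < t then i + t else i - t) \<and> \<not> tw' i"
    using chord_diagram_B_untwisted[OF odd_pos[OF \<open>odd t\<close>]] by blast
  have "ribbon_equiv G (B_untwisted t)"
  proof (rule chord_diagram_equiv[OF _ c(1)])
    show "chord_diagram G (2 * t) h \<pi> tw" using chord_diagram_axioms by (simp only: flip: Nt)
    fix i assume i: "i < 2 * t"
    then have "i < N" using Nt by simp
    then show "\<pi>' i = \<pi> i" "tw' i = tw i" using c(2)[OF i] \<pi> ntw by auto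
  qed
  then show ?thesis using \<open>odd t\<close> by (auto simp: B_family_def)
qed

end

text \<open>Induction on the number of corners: the factors of a cut inherit every hypothesis,
  constancy because the other factor contributes a fixed amount.\<close>

lemma const_sum_decompose:
  assumes "is_ribbon_graph G" "nb G {} = 1" "flags G \<noteq> {}" "const_sum G c"
  shows "\<exists>Ps R. (\<forall>P\<in>set Ps. \<exists>C\<in>B_family. ribbon_equiv P C) \<and> iterated_ribbon_join Ps R \<and> agree G R"
  using assms
proof (induction "card (flags G)" arbitrary: G c rule: less_induct)
  case less
  interpret G: ribbon_graph G by unfold_locales (rule less.prems)
  obtain x0 where "x0 \<in> flags G" using less.prems(3) by blast
  then obtain N h \<pi> tw where "chord_diagram G N h \<pi> tw"
    using G.bouquet_chord_diagram[OF less.prems(2)] by blast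
  then interpret const_chord_diagram G N h \<pi> tw c
    using less.prems(4) by (simp add: const_chord_diagram_def const_chord_diagram_axioms_def)
  show ?case
  proof (cases "\<forall>j<N. linked 0 j")
    case True
    then obtain C where "C \<in> B_family" "ribbon_equiv G C" using all_linked_in_family by blast
    then show ?thesis
      using iterated_ribbon_join.single[OF less.prems(1)]
      by (intro exI[of _ "[G]"] exI[of _ G]) (auto simp: agree_def)
  next
    case False
    then obtain u q where uq: "0 < u" "u < q" "q \<le> N" "\<pi> ` {u..<q} \<subseteq> {u..<q}"
      using exists_closed_interval by blast
    obtain P Q x y where PQ: "is_ribbon_graph P" "is_ribbon_graph Q" "x \<in> flags P" "y \<in> flags Q"
      "flags P \<inter> flags Q = {}" "agree G (ribbon_join P x Q y)"
      using cut_interval[OF uq] by blast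
    interpret J: join_setup P Q x y by unfold_locales (fact PQ)+
    have fl: "flags G = flags P \<union> flags Q" using PQ(6) J.flags_J by (simp add: agree_def)
    \<comment> \<open>For the empty edge set \<open>nb\<close> counts vertices; two in total and at
      least one each make both factors bouquets.\<close>
    have "nb P {} + nb Q {} = 2"
      using J.nb_join[OF edge_closed_empty] agree_nb[OF PQ(6), of "{}"] less.prems(2) by simp
    moreover have "0 < nb P {}" "0 < nb Q {}"
      using J.P.nb_pos[OF edge_closed_empty] J.Q.nb_pos[OF edge_closed_empty] PQ(3,4) by auto
    ultimately have nb1: "nb P {} = 1" "nb Q {} = 1" by linarith+
    obtain c1 c2 where c: "const_sum P c1" "const_sum Q c2"
      using J.const_sum_join_factors agree_const_sum[OF PQ(6)] less.prems(4) by blast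
    have "flags P \<subset> flags G" "flags Q \<subset> flags G" using fl PQ(3-5) by auto
    then have lt: "card (flags P) < card (flags G)" "card (flags Q) < card (flags G)"
      using psubset_card_mono[OF G.finX] by blast+
    have ne: "flags P \<noteq> {}" "flags Q \<noteq> {}" using PQ(3,4) by auto
    obtain Ps RP where P: "\<forall>P\<in>set Ps. \<exists>C\<in>B_family. ribbon_equiv P C" "iterated_ribbon_join Ps RP" "agree P RP"
      using less.hyps[OF lt(1) PQ(1) nb1(1) ne(1) c(1)] by blast
    obtain Qs RQ where Q: "\<forall>P\<in>set Qs. \<exists>C\<in>B_family. ribbon_equiv P C" "iterated_ribbon_join Qs RQ" "agree Q RQ"
      using less.hyps[OF lt(2) PQ(2) nb1(2) ne(2) c(2)] by blast
    have f: "flags RP = flags P" "flags RQ = flags Q" using P(3) Q(3) by (simp_all add: agree_def)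
    have "iterated_ribbon_join (Ps @ Qs) (ribbon_join RP x RQ y)"
      by (rule iterated_ribbon_join.join[OF P(2) Q(2)]) (use f PQ in auto)
    moreover have "agree G (ribbon_join RP x RQ y)"
      by (rule agree_trans[OF PQ(6) agree_ribbon_join[OF P(3) Q(3) PQ(3-5)]])
    moreover have "\<forall>P\<in>set (Ps @ Qs). \<exists>C\<in>B_family. ribbon_equiv P C" using P(1) Q(1) by auto
    ultimately show ?thesis by blast
  qed
qed

theorem theorem22:
  fixes B :: "'a ribbon_graph"
  assumes "is_bouquet B" and "edges B \<noteq> {}"
  shows "((\<exists>b. partial_dual_genus_poly B = monom (2 ^ card (edges B)) b) \<longleftrightarrow>
            (\<exists>Ps. length Ps \<ge> 1 \<and> is_B_family_join B Ps)) \<and>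
         (\<forall>b Ps. partial_dual_genus_poly B = monom (2 ^ card (edges B)) b \<and> is_B_family_join B Ps \<longrightarrow>
            int b = int (card (edges B)) - int (length Ps)
                    + int (length (filter (\<lambda>P. ribbon_equiv P B_twisted) Ps)))"
proof -
  interpret ribbon_graph B using assms by unfold_locales (simp add: is_bouquet_def)
  let ?n = "card (edges B)"
  note iff = partial_dual_genus_poly_monom_iff[OF assms(1)]
  have nb1: "nb B {} = 1" using assms(1) vertices_eq by (simp add: is_bouquet_def)
  have X: "X \<noteq> {}" using assms(2) by (auto simp: edges_eq)
  have join: "const_sum B (2 + length (filter (\<lambda>P. \<not> ribbon_equiv P B_twisted) Ps))"
    if "is_B_family_join B Ps" for Ps
    using that const_sum_iterated_join const_sum_equiv_imp[OF rg] unfolding is_B_family_join_def by blast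
  have c_eq: "c = nb B {} + nb B X" if "const_sum B c" for c
    using that edge_closed_empty unfolding const_sum_def by fastforce
  have fwd: "\<exists>Ps. length Ps \<ge> 1 \<and> is_B_family_join B Ps"
    if b: "partial_dual_genus_poly B = monom (2 ^ ?n) b" for b
  proof -
    obtain c where "const_sum B c" using b iff by blast
    then obtain Ps R where Ps: "\<forall>P\<in>set Ps. \<exists>C\<in>B_family. ribbon_equiv P C"
        "iterated_ribbon_join Ps R" "agree B R"
      using const_sum_decompose[OF rg nb1 X] by blast
    have "length Ps \<ge> 1" using Ps(2) by (induction rule: iterated_ribbon_join.induct) auto
    then show ?thesis using Ps agree_ribbon_equiv unfolding is_B_family_join_def by blast
  qed
  have bwd: "\<exists>b. partial_dual_genus_poly B = monom (2 ^ ?n) b" if "is_B_family_join B Ps" for Ps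
  proof -
    let ?c = "2 + length (filter (\<lambda>P. \<not> ribbon_equiv P B_twisted) Ps)"
    have "?c = nb B {} + nb B X" by (rule c_eq[OF join[OF that]])
    \<comment> \<open>This makes \<open>?n + 2 - ?c\<close> a true difference, so that it can serve
      as the exponent.\<close>
    moreover have "4 * nb B X \<le> 4 + 4 * ?n" using nb_le[OF edge_closed_flags] nb1 card_flags by simp
    ultimately have "(?n + 2 - ?c) + ?c = ?n + 2" using nb1 by simp
    then show ?thesis using iff join[OF that] by blast
  qed
  have val: "int b = int ?n - int (length Ps) + int (length (filter (\<lambda>P. ribbon_equiv P B_twisted) Ps))"
    if b: "partial_dual_genus_poly B = monom (2 ^ ?n) b" and j: "is_B_family_join B Ps" for b Ps
  proof -
    obtain c where c: "const_sum B c" "b + c = ?n + 2" using b iff by blast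
    \<comment> \<open>The constant is \<open>nb B {} + nb B X\<close>, determined by
      \<open>B\<close> alone, so every decomposition has the same number of untwisted
      factors.\<close>
    have "c = 2 + length (filter (\<lambda>P. \<not> ribbon_equiv P B_twisted) Ps)"
      using c_eq[OF c(1)] c_eq[OF join[OF j]] by simp
    then show ?thesis
      using c(2) sum_length_filter_compl[of "\<lambda>P. ribbon_equiv P B_twisted" Ps] by linarith
  qed
  show ?thesis using fwd bwd val by blast
qed
end
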